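(* Let $G$ be a countably infinite group with $K(G)\cong\mathbb{Z}_{p^n}$ (cyclic of order $p^n$) for a prime $p$ and an integer $n\ge1$. Then $G$ has an infinite section $H=L/N$ with $L$ of finite index in $G$, such that $H$ is a $p$-group, $K(H)=\langle a\rangle\cong\mathbb{Z}_p$ for some $a\in H$, and $\eta(a,H)=\{1\}$.
   Context: For an infinite group $G$ and $g\in G$, let $\eta(g,G)=\{h\in G : g\notin\langle h\rangle\}$, i.e. the set of $h\in G$ such that $h^k=g$ has no solution $k\in\mathbb{Z}$. Define $K(G)=\{k\in G : |\eta(k,G)|<|G|\}$. A section of $G$ is a factor group $L/N$ of a subgroup $L\le G$ by a normal subgroup $N$ of $L$. *)

theory Defs
  imports
    "HOL-Algebra.Elementary_Groups"
    "HOL-Algebra.Multiplicative_Group"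
    "HOL-Computational_Algebra.Primes"
    "HOL-Library.Countable_Set"
    "HOL-Library.Equipollence"
begin

definition eta :: "'a \<Rightarrow> ('a, 'b) monoid_scheme \<Rightarrow> 'a set" where
  "eta g G = {h \<in> carrier G. g \<notin> generate G {h}}"

definition Ksub :: "('a, 'b) monoid_scheme \<Rightarrow> 'a set" where
  "Ksub G = {k \<in> carrier G. eta k G \<prec> carrier G}"

definition p_group :: "nat \<Rightarrow> ('a, 'b) monoid_scheme \<Rightarrow> bool" where
  \<comment> \<open>Infinite groups are allowed. As \<^term>\<open>group.ord G x = 0\<close> for elements of infinite order,
    those are excluded.\<close>
  "p_group p G \<longleftrightarrow> group G \<and> (\<forall>x\<in>carrier G. \<exists>m. group.ord G x = p ^ m)"

lemma (in group) eta_eq_int_pow: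
  "eta g G = {h \<in> carrier G. \<not> (\<exists>k::int. h [^] k = g)}"
  by (auto simp: eta_def generate_pow)

lemma lesspoll_iff_card_of_ordLess: "A \<prec> B \<longleftrightarrow> (card_of A, card_of B) \<in> ordLess"
  unfolding lesspoll_def lepoll_def card_of_ordLeq eqpoll_iff_card_of_ordIso
  using ordLeq_iff_ordLess_or_ordIso not_ordLess_ordIso by blast

text \<open>\<^const>\<open>Ksub\<close> is a subgroup of any infinite group, so it makes sense to speak of its
  isomorphism type.\<close>

lemma (in group) subgroup_Ksub:
  assumes inf: "infinite (carrier G)"
  shows "subgroup (Ksub G) G"
proof (rule subgroupI)
  show "Ksub G \<subseteq> carrier G"
    by (auto simp: Ksub_def)
  have "eta \<one> G = {}"
    by (auto simp: eta_def intro: generate.one)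
  moreover have "{} \<prec> carrier G"
    using inf by (simp add: finite_lesspoll_infinite)
  ultimately show "Ksub G \<noteq> {}"
    by (auto simp: Ksub_def)
next
  fix x assume x: "x \<in> Ksub G"
  have "eta (inv x) G \<subseteq> eta x G"
  proof
    fix h assume h: "h \<in> eta (inv x) G"
    then have hc: "h \<in> carrier G" and n: "inv x \<notin> generate G {h}"
      by (auto simp: eta_def)
    have "subgroup (generate G {h}) G"
      using hc by (intro generate_is_subgroup) auto
    then show "h \<in> eta x G"
      using n hc by (auto simp: eta_def subgroup.m_inv_closed)
  qed
  then show "inv x \<in> Ksub G"
    using x by (auto simp: Ksub_def intro: lesspoll_trans1 subset_imp_lepoll)
next
  fix x y assume x: "x \<in> Ksub G" and y: "y \<in> Ksub G"
  have "eta (x \<otimes> y) G \<subseteq> eta x G \<union> eta y G"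
    by (auto simp: eta_def intro: generate.eng)
  moreover have "eta x G \<union> eta y G \<prec> carrier G"
    using x y inf card_of_Un_ordLess_infinite
    by (auto simp: Ksub_def lesspoll_iff_card_of_ordLess)
  ultimately show "x \<otimes> y \<in> Ksub G"
    using x y by (auto simp: Ksub_def intro: lesspoll_trans1 subset_imp_lepoll)
qed

end

theory Submission
  imports Defs "HOL-Algebra.Zassenhaus"
begin

text \<open>
  Let \<open>k\<close> generate \<open>K(G)\<close>. Since \<open>\<eta>(k)\<close> is finite, \<open>G\<close> is a torsion group, \<open>k\<close> is central, and the
  centraliser \<open>C\<close> of \<open>\<eta>(k)\<close> has finite index. Let \<open>N\<close> be maximal among the central subgroups of \<open>C\<close> that
  contain \<open>k\<^sup>p\<close> but not \<open>k\<close>. An element of \<open>C\<close> that does not have \<open>k\<close> as a power is central in \<open>C\<close>, so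
  by maximality \<open>kN\<close> is a power of every nontrivial element of \<open>Q = C/N\<close>. Hence \<open>Q\<close> is a \<open>p\<close>-group in
  which any two commuting elements are comparable (one is a power of the other), and \<open>K(Q)\<close> is central.

  If the centre of \<open>Q\<close> is finite, it is cyclic, say generated by \<open>b\<close>, and \<open>Q/\<langle>b\<^sup>p\<rangle>\<close> is the section.

  Otherwise \<open>Q\<close> is a Pruefer group, and \<open>K(Q) = Q\<close> is too large. Then \<open>C\<close> is abelian, and its subgroup
  \<open>D\<close> of \<open>|N|\<close>-th powers is a Pruefer group of finite index, normal in \<open>G\<close>. It is not central, as
  otherwise \<open>D \<subseteq> K(G)\<close>. Let \<open>g\<close> have minimal order among the elements not centralising \<open>D\<close>. All elements
  of \<open>Dg\<close> are conjugate, so \<open>k \<in> \<langle>g\<rangle>\<close>, the order of \<open>g\<close> is a power of \<open>p\<close>, and \<open>(dg)\<^sup>p = g\<^sup>p\<close> for all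
  \<open>d \<in> D\<close>. This forces \<open>p = 2\<close> and makes \<open>g\<close> invert \<open>D\<close>; a quotient of \<open>D\<langle>g\<rangle>\<close> by a finite subgroup is
  then the infinite generalised quaternion group.
\<close>

section \<open>Cyclic subgroups\<close>

context group
begin

lemma generate_singleton_iff:
  "x \<in> carrier G \<Longrightarrow> y \<in> generate G {x} \<longleftrightarrow> (\<exists>i::int. y = x [^] i)"
  by (auto simp: generate_pow)

lemma generate_singleton_self: "x \<in> carrier G \<Longrightarrow> x \<in> generate G {x}"
  by (simp add: generate.incl)

lemma generate_singleton_closed:
  "x \<in> carrier G \<Longrightarrow> y \<in> generate G {x} \<Longrightarrow> y \<in> carrier G"
  by (auto simp: generate_singleton_iff)

lemma int_pow_in_generate: "x \<in> carrier G \<Longrightarrow> x [^] (i::int) \<in> generate G {x}"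
  by (auto simp: generate_singleton_iff)

lemma subgroup_generate_singleton: "x \<in> carrier G \<Longrightarrow> subgroup (generate G {x}) G"
  by (simp add: generate_is_subgroup)

lemma generate_singleton_trans:
  assumes "x \<in> carrier G" "y \<in> generate G {x}" "z \<in> generate G {y}"
  shows "z \<in> generate G {x}"
  by (meson assms empty_subsetI generate_subgroup_incl insert_subset subgroup_generate_singleton subsetD)

lemma generate_singleton_in_subgroup:
  assumes "subgroup H G" "x \<in> H" "y \<in> generate G {x}"
  shows "y \<in> H"
  by (meson assms empty_subsetI generate_subgroup_incl insert_subset subsetD)

lemma finite_generate_singleton:
  assumes "x \<in> carrier G" "ord x \<noteq> 0"
  shows "finite (generate G {x})"
  using assms generate_pow_card card.infinite by metis

lemma int_pow_commute:
  assumes "x \<otimes> y = y \<otimes> x" "x \<in> carrier G" "y \<in> carrier G"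
  shows "x [^] (i::int) \<otimes> y [^] (j::int) = y [^] j \<otimes> x [^] i"
proof -
  have inv_comm: "inv v \<otimes> u = u \<otimes> inv v"
    if "u \<otimes> v = v \<otimes> u" "u \<in> carrier G" "v \<in> carrier G" for u v
    by (metis inv_closed inv_solve_left inv_solve_right m_assoc m_closed that)
  have *: "u \<otimes> v [^] (j::int) = v [^] j \<otimes> u"
    if uv: "u \<otimes> v = v \<otimes> u" "u \<in> carrier G" "v \<in> carrier G" for u v j
  proof (cases "j \<ge> 0")
    case True
    then show ?thesis
      using group_commutes_pow[of v u "nat j"] uv by simp
  next
    case False
    have "v [^] nat (-j) \<otimes> u = u \<otimes> v [^] nat (-j)"
      using group_commutes_pow[of v u "nat (-j)"] uv by simp
    moreover have "v [^] j = inv (v [^] nat (-j))"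
      using False by (simp add: int_pow_def2 del: pow_nat)
    ultimately show ?thesis
      using inv_comm[of u "v [^] nat (-j)"] uv by simp
  qed
  have "x \<otimes> y [^] j = y [^] j \<otimes> x"
    using *[OF assms] .
  then show ?thesis
    using *[of "y [^] j" x i] assms by simp
qed

lemma generate_singleton_commute:
  assumes "x \<in> generate G {y}" "y \<in> carrier G" "y \<otimes> z = z \<otimes> y" "z \<in> carrier G"
  shows "x \<otimes> z = z \<otimes> x"
  using assms int_pow_commute[of y z _ 1] by (auto simp: generate_singleton_iff)

lemma inv_cancel_left:
  assumes "x \<in> carrier G" "y \<in> carrier G"
  shows "inv x \<otimes> (x \<otimes> y) = y" "x \<otimes> (inv x \<otimes> y) = y"
  using assms by (simp_all add: m_assoc[symmetric])

lemma int_pow_conjugate: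
  assumes "c \<in> carrier G" "g \<in> carrier G"
  shows "(c \<otimes> g \<otimes> inv c) [^] (i::int) = c \<otimes> g [^] i \<otimes> inv c"
proof -
  have "(\<lambda>x. c \<otimes> x \<otimes> inv c) \<in> hom G G"
    using assms by (intro homI) (auto simp: m_assoc inv_solve_left)
  then show ?thesis
    using hom_int_pow[of "\<lambda>x. c \<otimes> x \<otimes> inv c" G G g i] assms is_group by simp
qed

text \<open>Conjugation by \<open>c\<close> fixes \<open>k\<close>, so undoing it turns
  \<open>k\<close> as a power of the conjugate into the same power of \<open>g\<close>.\<close>

lemma central_in_generate_conjugate:
  assumes k: "k \<in> carrier G" "k \<otimes> c = c \<otimes> k" and c: "c \<in> carrier G" and g: "g \<in> carrier G"
    and gen: "k \<in> generate G {c \<otimes> g \<otimes> inv c}"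
  shows "k \<in> generate G {g}"
proof -
  obtain i :: int where i: "k = c \<otimes> g [^] i \<otimes> inv c"
    using gen c g generate_singleton_iff[of "c \<otimes> g \<otimes> inv c" k] by (auto simp: int_pow_conjugate)
  have "k \<otimes> c = c \<otimes> g [^] i"
    unfolding i using c g by (simp add: m_assoc)
  then have "k = g [^] i"
    using k c g by simp
  then show ?thesis
    using g int_pow_in_generate by blast
qed

text \<open>Bezout: an inverse of \<open>i\<close> modulo \<open>m\<close> recovers \<open>x\<close>
  from \<open>x [^] i\<close>.\<close>

lemma generate_int_pow_coprime:
  assumes x: "x \<in> carrier G" and m: "x [^] (m::int) = \<one>" and co: "coprime m i"
  shows "x \<in> generate G {x [^] i}"
proof -
  obtain u v where uv: "u * m + v * i = 1"
    using co bezout_int[of m i] by (metis coprime_imp_gcd_eq_1)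
  have "x = x [^] (m * u + i * v)"
    using x uv by (simp add: mult.commute)
  also have "\<dots> = (x [^] m) [^] u \<otimes> (x [^] i) [^] v"
    using x by (simp add: int_pow_mult int_pow_pow)
  also have "\<dots> = (x [^] i) [^] v"
    using x m by simp
  finally show ?thesis
    using x generate_singleton_iff[of "x [^] i" x] by blast
qed

lemma ord_ne_0I:
  assumes "x \<in> carrier G" "x [^] (i::int) = \<one>" "i \<noteq> 0"
  shows "ord x \<noteq> 0"
  using assms by (auto simp: int_pow_eq_id)

text \<open>An element outside \<open>S\<close> would give a coset of \<open>S\<close> that is
  disjoint from \<open>S\<close>, yet as infinite as \<open>S\<close>.\<close>

lemma cofinite_subgroup_eq_carrier:
  assumes inf: "infinite (carrier G)" and S: "subgroup S G" and fin: "finite (carrier G - S)"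
  shows "S = carrier G"
proof (rule ccontr)
  assume "S \<noteq> carrier G"
  then obtain x where x: "x \<in> carrier G" "x \<notin> S"
    using subgroup.subset[OF S] by blast
  have "infinite S"
    using inf fin by (metis finite_Diff2)
  moreover have "inj_on (\<lambda>s. x \<otimes> s) S"
    using inj_on_cmult[OF x(1)] subgroup.subset[OF S] inj_on_subset by blast
  ultimately have "infinite ((\<lambda>s. x \<otimes> s) ` S)"
    using finite_imageD by blast
  moreover have "(\<lambda>s. x \<otimes> s) ` S \<subseteq> carrier G - S"
  proof clarify
    fix s assume s: "s \<in> S"
    then have sc: "s \<in> carrier G"
      using subgroup.subset[OF S] by blast
    have "x \<in> S" if "x \<otimes> s \<in> S"
    proof -
      have "x \<otimes> s \<otimes> inv s \<in> S"
        using that s S by (simp add: subgroup.m_closed subgroup.m_inv_closed)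
      then show ?thesis
        using x(1) sc by (simp add: m_assoc)
    qed
    then show "x \<otimes> s \<in> carrier G - S"
      using x sc by auto
  qed
  ultimately show False
    using fin finite_subset by blast
qed

lemma subgroup_commuting:
  assumes "F \<subseteq> carrier G"
  shows "subgroup {x \<in> carrier G. \<forall>f\<in>F. x \<otimes> f = f \<otimes> x} G"
proof (rule subgroupI)
  show "{x \<in> carrier G. \<forall>f\<in>F. x \<otimes> f = f \<otimes> x} \<noteq> {}"
    using assms by (auto intro!: exI[of _ \<one>])
next
  fix x assume "x \<in> {x \<in> carrier G. \<forall>f\<in>F. x \<otimes> f = f \<otimes> x}"
  then show "inv x \<in> {x \<in> carrier G. \<forall>f\<in>F. x \<otimes> f = f \<otimes> x}"
    using int_pow_commute[of x _ "-1" 1] assms by (auto simp: int_pow_neg subset_iff)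
next
  fix x y
  assume "x \<in> {x \<in> carrier G. \<forall>f\<in>F. x \<otimes> f = f \<otimes> x}" "y \<in> {x \<in> carrier G. \<forall>f\<in>F. x \<otimes> f = f \<otimes> x}"
  then show "x \<otimes> y \<in> {x \<in> carrier G. \<forall>f\<in>F. x \<otimes> f = f \<otimes> x}"
    using assms by (auto simp: subset_iff) (metis m_assoc)
qed auto

text \<open>Whatever has \<open>k\<close> as a power commutes with \<open>k\<close>, so the
  centraliser of \<open>k\<close> misses only elements of \<open>eta k G\<close> and is therefore
  cofinite.\<close>

lemma finite_eta_imp_central:
  assumes inf: "infinite (carrier G)" and k: "k \<in> carrier G" and fin: "finite (eta k G)"
    and x: "x \<in> carrier G"
  shows "k \<otimes> x = x \<otimes> k"
proof -
  let ?C = "{x \<in> carrier G. \<forall>f\<in>{k}. x \<otimes> f = f \<otimes> x}"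
  have "carrier G - ?C \<subseteq> eta k G"
  proof
    fix y assume y: "y \<in> carrier G - ?C"
    have "k \<notin> generate G {y}"
      using generate_singleton_commute[of k y y] y k by auto
    then show "y \<in> eta k G"
      using y by (auto simp: eta_def)
  qed
  then have "?C = carrier G"
    using cofinite_subgroup_eq_carrier[OF inf subgroup_commuting] k fin finite_subset by blast
  then have "x \<in> ?C"
    using x by blast
  then show ?thesis
    by simp
qed

text \<open>An element of infinite order has no nontrivial powers of finite order, so all its
  infinitely many nonzero powers would lie in \<open>eta k G\<close>.\<close>

lemma finite_eta_imp_torsion:
  assumes k: "k \<in> carrier G" "k \<noteq> \<one>" "ord k \<noteq> 0" and fin: "finite (eta k G)"
    and x: "x \<in> carrier G"
  shows "ord x \<noteq> 0"
proof
  assume 0: "ord x = 0"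
  have "x [^] (i::int) \<in> eta k G" if "i \<noteq> 0" for i
  proof (rule ccontr)
    assume "x [^] i \<notin> eta k G"
    then obtain j :: int where j: "k = x [^] (i * j)"
      using x by (auto simp: eta_eq_int_pow int_pow_pow)
    have "x [^] (i * j * int (ord k)) = \<one>"
      using j k(1) x by (metis int_pow_int int_pow_pow pow_ord_eq_1)
    then have "i * j * int (ord k) = 0"
      using 0 x by (simp add: int_pow_eq_id)
    then show False
      using j k x that by auto
  qed
  then have "(\<lambda>i::int. x [^] i) ` (UNIV - {0}) \<subseteq> eta k G"
    by auto
  moreover have "inj_on (\<lambda>i::int. x [^] i) (UNIV - {0})"
    using x 0 by (auto simp: inj_on_def int_pow_eq)
  moreover have "infinite (UNIV - {0::int})"
    by (simp add: infinite_UNIV_int)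
  ultimately show False
    using fin by (metis finite_imageD finite_subset)
qed

section \<open>Subgroups of finite index\<close>

lemma finite_rcosets_mono:
  assumes D: "subgroup D G" and L: "subgroup L G" and sub: "D \<subseteq> L" and fin: "finite (rcosets D)"
  shows "finite (rcosets L)"
proof (rule finite_surj[OF fin])
  \<comment> \<open>Multiplication by \<open>L\<close> sends the coset \<open>D #> x\<close> to
    \<open>L #> x\<close>, hence maps onto the cosets of \<open>L\<close>.\<close>
  show "rcosets L \<subseteq> (\<lambda>X. L <#> X) ` (rcosets D)"
  proof
    fix Y assume "Y \<in> rcosets L"
    then obtain x where x: "x \<in> carrier G" "Y = L #> x"
      by (auto simp: RCOSETS_def)
    have "L <#> (D #> x) = (L <#> D) #> x"
      using x L D by (simp add: setmult_rcos_assoc subgroup.subset)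
    also have "L <#> D = L"
      using subgroup_incl[OF D L sub]
      by (metis L set_mult_consistent set_mult_subgroup_idem)
    finally show "Y \<in> (\<lambda>X. L <#> X) ` (rcosets D)"
      using x by (auto simp: RCOSETS_def)
  qed
qed

lemma infinite_finite_index:
  assumes "infinite (carrier G)" "subgroup D G" "finite (rcosets D)"
  shows "infinite D"
proof
  assume "finite D"
  then have "finite (\<Union>(rcosets D))"
    using assms rcosets_finite subgroup.subset by blast
  then show False
    using assms rcosets_part_G by simp
qed

text \<open>With representatives \<open>r X\<close> for the cosets of \<open>C\<close>, each coset
  of \<open>D\<close> has the form \<open>D #> (h \<otimes> r X)\<close> with \<open>h\<close> in
  the finite set \<open>N\<close>.\<close>

lemma finite_index_trans:
  assumes D: "subgroup D G" and C: "subgroup C G" "finite (rcosets C)"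
    and N: "finite N" "N \<subseteq> carrier G" and cover: "\<And>x. x \<in> C \<Longrightarrow> \<exists>d\<in>D. \<exists>h\<in>N. x = d \<otimes> h"
  shows "finite (rcosets D)"
proof -
  define r where "r X = (SOME x. x \<in> carrier G \<and> X = C #> x)" for X
  have r: "r X \<in> carrier G \<and> X = C #> r X" if "X \<in> rcosets C" for X
    unfolding r_def by (rule someI_ex) (use that in \<open>auto simp: RCOSETS_def\<close>)
  have "rcosets D \<subseteq> (\<lambda>(h, X). D #> (h \<otimes> r X)) ` (N \<times> rcosets C)"
  proof
    fix Y assume "Y \<in> rcosets D"
    then obtain x where x: "x \<in> carrier G" "Y = D #> x"
      by (auto simp: RCOSETS_def)
    define X where "X = C #> x"
    have X: "X \<in> rcosets C" "x \<in> X"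
      unfolding X_def using rcosetsI[OF subgroup.subset[OF C(1)] x(1)] rcos_self[OF x(1) C(1)] by auto
    then obtain c where c: "c \<in> C" "x = c \<otimes> r X"
      using r[OF X(1)] by (auto simp: r_coset_def)
    obtain d h where dh: "d \<in> D" "h \<in> N" "c = d \<otimes> h"
      using cover[OF c(1)] by blast
    have cl: "d \<in> carrier G" "h \<in> carrier G" "r X \<in> carrier G"
      using dh N D r[OF X(1)] subgroup.subset by blast+
    have "Y = D #> d #> (h \<otimes> r X)"
      unfolding x(2) c(2) dh(3) using cl D by (simp add: coset_mult_assoc m_assoc subgroup.subset)
    also have "D #> d = D"
      using dh D cl by (simp add: coset_join2)
    finally show "Y \<in> (\<lambda>(h, X). D #> (h \<otimes> r X)) ` (N \<times> rcosets C)"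
      using dh(2) X(1) by auto
  qed
  moreover have "finite ((\<lambda>(h, X). D #> (h \<otimes> r X)) ` (N \<times> rcosets C))"
    using N C by simp
  ultimately show ?thesis
    by (rule finite_subset)
qed

text \<open>The coset of the centraliser that contains \<open>x\<close> is determined by how
  \<open>inv x\<close> acts on \<open>F\<close> by conjugation, and a finite set has only finitely
  many self-maps.\<close>

lemma finite_index_commuting:
  assumes fin: "finite F" and F: "F \<subseteq> carrier G"
    and conj: "\<And>x f. x \<in> carrier G \<Longrightarrow> f \<in> F \<Longrightarrow> x \<otimes> f \<otimes> inv x \<in> F"
  shows "finite (rcosets {x \<in> carrier G. \<forall>f\<in>F. x \<otimes> f = f \<otimes> x})" (is "finite (rcosets ?C)")
proof -
  have C: "subgroup ?C G"
    by (rule subgroup_commuting[OF F])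
  define \<theta> where "\<theta> x = (\<lambda>f\<in>F. inv x \<otimes> f \<otimes> x)" for x
  have fin_\<theta>: "finite (\<theta> ` carrier G)"
  proof (rule finite_subset)
    show "\<theta> ` carrier G \<subseteq> F \<rightarrow>\<^sub>E F"
      using conj[OF inv_closed] by (auto simp: \<theta>_def)
    show "finite (F \<rightarrow>\<^sub>E F)"
      using fin by (intro finite_PiE) auto
  qed
  have eq: "?C #> x = ?C #> y" if x: "x \<in> carrier G" and y: "y \<in> carrier G" and \<theta>: "\<theta> x = \<theta> y" for x y
  proof -
    have "x \<otimes> inv y \<otimes> f = f \<otimes> (x \<otimes> inv y)" if f: "f \<in> F" for f
    proof -
      have fc: "f \<in> carrier G"
        using f F by blast
      have "inv x \<otimes> f \<otimes> x = inv y \<otimes> f \<otimes> y"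
        using fun_cong[OF \<theta>, of f] f by (simp add: \<theta>_def)
      then have "x \<otimes> (inv y \<otimes> f \<otimes> y) \<otimes> inv y = x \<otimes> (inv x \<otimes> f \<otimes> x) \<otimes> inv y"
        by simp
      then show ?thesis
        using x y fc by (simp add: m_assoc inv_cancel_left)
    qed
    then have "x \<otimes> inv y \<in> ?C"
      using x y by simp
    then have "x \<in> ?C #> y"
      using subgroup.rcos_module[OF C is_group y x] by simp
    then show ?thesis
      using repr_independence[OF _ y C] by simp
  qed
  have "rcosets ?C \<subseteq> (\<lambda>t. ?C #> inv_into (carrier G) \<theta> t) ` \<theta> ` carrier G"
  proof
    fix X assume "X \<in> rcosets ?C"
    then obtain x where x: "x \<in> carrier G" "X = ?C #> x"
      unfolding RCOSETS_def by blast
    have "X = ?C #> inv_into (carrier G) \<theta> (\<theta> x)"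
      unfolding x(2) using x(1) by (intro eq) (auto simp: inv_into_into f_inv_into_f)
    then show "X \<in> (\<lambda>t. ?C #> inv_into (carrier G) \<theta> t) ` \<theta> ` carrier G"
      using x(1) by blast
  qed
  then show ?thesis
    using fin_\<theta> finite_surj by blast
qed

end

lemma nat_prime_power_if_unique_prime:
  fixes n p :: nat
  assumes "n \<noteq> 0" "prime p" "\<And>q. prime q \<Longrightarrow> q dvd n \<Longrightarrow> q = p"
  shows "\<exists>m. n = p ^ m"
proof -
  obtain y where y: "n = p ^ multiplicity p n * y" "\<not> p dvd y"
    using multiplicity_decompose'[of n p] assms(1,2) not_prime_unit by blast
  have "y = 1"
  proof (rule ccontr)
    assume "y \<noteq> 1"
    then obtain q where "prime q" "q dvd y"
      using prime_factor_nat by blast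
    then show False
      using assms(3)[of q] y by (metis dvd_mult)
  qed
  then show ?thesis
    using y by auto
qed

section \<open>Groups with a unique minimal subgroup\<close>

text \<open>The subgroup generated by \<open>a\<close> has order \<open>p\<close> and lies in every
  nontrivial subgroup, as in nontrivial cyclic \<open>p\<close>-groups, Pruefer groups and
  generalised quaternion groups.\<close>

locale prime_socle = group G for G (structure) +
  fixes p :: nat and a
  assumes prime: "prime p"
    and a_closed: "a \<in> carrier G" and a_ne_one: "a \<noteq> \<one>" and a_pow: "a [^] int p = \<one>"
    and socle: "\<lbrakk>x \<in> carrier G; x \<noteq> \<one>\<rbrakk> \<Longrightarrow> a \<in> generate G {x}"
begin

lemma ord_ne_0: "x \<in> carrier G \<Longrightarrow> ord x \<noteq> 0"
proof (cases "x = \<one>")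
  case False
  assume x: "x \<in> carrier G"
  then obtain i :: int where i: "a = x [^] i"
    using socle False generate_singleton_iff by blast
  then have "x [^] (i * int p) = \<one>"
    using a_pow x by (metis int_pow_pow)
  moreover have "i * int p \<noteq> 0"
    using i a_ne_one prime by (auto simp: prime_gt_0_nat)
  ultimately show ?thesis
    using x ord_ne_0I by blast
qed simp

lemma ord_a: "ord a = p"
proof -
  have "ord a dvd p"
    using a_pow a_closed by (simp add: int_pow_eq_id)
  then show ?thesis
    using prime a_ne_one a_closed ord_eq_1 by (auto simp: prime_nat_iff)
qed

text \<open>If a prime \<open>q\<close> divides \<open>ord x\<close>, some power of \<open>x\<close>
  has order \<open>q\<close>; as \<open>a\<close> is a power of that element,
  \<open>q = p\<close>.\<close>

lemma ord_prime_power: "x \<in> carrier G \<Longrightarrow> \<exists>m. ord x = p ^ m"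
proof (rule nat_prime_power_if_unique_prime[OF ord_ne_0 prime])
  fix q assume x: "x \<in> carrier G" and q: "prime q" "q dvd ord x"
  define y where "y = x [^] (ord x div q)"
  have y: "y \<in> carrier G"
    using x y_def by simp
  have "ord y = ord x div (ord x div q)"
    unfolding y_def using x q ord_ne_0[OF x] by (intro ord_pow) (auto elim!: dvdE)
  then have oy: "ord y = q"
    using q ord_ne_0[OF x] by (auto elim!: dvdE)
  then have "y \<noteq> \<one>"
    using q by auto
  then obtain i :: int where "a = y [^] i"
    using socle y generate_singleton_iff by blast
  then have "a [^] int q = \<one>"
    using y oy by (metis int_pow_eq_id int_pow_pow dvd_triv_right)
  then have "p dvd q"
    using a_closed ord_a by (simp add: int_pow_eq_id)
  then show "q = p"
    using prime q primes_dvd_imp_eq by blast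
qed

lemma ord_p_in_generate:
  assumes "y \<in> carrier G" "y [^] int p = \<one>"
  shows "y \<in> generate G {a}"
proof (cases "y = \<one>")
  case False
  then obtain i :: int where i: "a = y [^] i"
    using socle assms generate_singleton_iff by blast
  have "\<not> int p dvd i"
    using i assms a_ne_one by (auto simp: int_pow_eq_id)
  then have "coprime (int p) i"
    using prime by (simp add: prime_imp_coprime)
  then show ?thesis
    using generate_int_pow_coprime[OF assms] i by simp
qed (simp add: generate.one)

text \<open>Induction on \<open>s\<close>: \<open>f [^] p\<close> is already a power of
  \<open>b\<close>. Dividing \<open>f\<close> by a \<open>p\<close>-th root of that power, taken
  among the powers of \<open>b\<close>, leaves an element killed by \<open>p\<close>; it lies in
  \<open>generate G {a}\<close>, hence in \<open>generate G {b}\<close>.\<close>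

lemma in_generate_if_ord_le:
  assumes "f \<in> carrier G" "b \<in> carrier G" "ord f = p ^ s" "ord b = p ^ t" "s \<le> t" "f \<otimes> b = b \<otimes> f"
  shows "f \<in> generate G {b}"
  using assms
proof (induction s arbitrary: f)
  case 0
  then show ?case
    using ord_eq_1 by (auto intro: generate.one)
next
  case (Suc s)
  have f: "f \<in> carrier G" and b: "b \<in> carrier G"
    using Suc by auto
  have "ord (f [^] p) = p ^ s"
    using Suc.prems prime prime_gt_0_nat[OF prime] by (subst ord_pow) auto
  moreover have "f [^] p \<otimes> b = b \<otimes> f [^] p"
    using Suc.prems group_commutes_pow by blast
  ultimately have "f [^] p \<in> generate G {b}"
    using Suc by simp
  then obtain j :: int where j: "f [^] int p = b [^] j"
    using b by (auto simp: generate_singleton_iff int_pow_int)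
  \<comment> \<open>Comparing orders: \<open>p ^ t\<close> divides \<open>j * p ^ s\<close> although
    \<open>s < t\<close>, so \<open>p\<close> divides \<open>j\<close> and the required root
    exists.\<close>
  have "b [^] (j * int (p ^ s)) = (f [^] int p) [^] int (p ^ s)"
    using j b by (simp add: int_pow_pow)
  also have "\<dots> = f [^] int (ord f)"
    using Suc.prems by (simp add: int_pow_pow)
  also have "\<dots> = \<one>"
    using f by (simp add: int_pow_int)
  finally have "int (p ^ t) dvd j * int (p ^ s)"
    using b Suc.prems by (simp add: int_pow_eq_id)
  moreover have "int p * int (p ^ s) dvd int (p ^ t)"
    using Suc.prems(5) by (metis le_imp_power_dvd of_nat_mult of_nat_dvd_iff power_Suc)
  ultimately have "int p * int (p ^ s) dvd j * int (p ^ s)"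
    using dvd_trans by blast
  then obtain j' where j': "j = int p * j'"
    using prime_gt_0_nat[OF prime] by (auto elim!: dvdE)
  define y where "y = f \<otimes> b [^] (- j')"
  have y: "y \<in> carrier G"
    using f b y_def by simp
  have "y [^] int p = f [^] int p \<otimes> (b [^] (- j')) [^] int p"
    unfolding y_def using int_pow_commute[OF Suc.prems(6) f b, of 1 "-j'"] f b
    by (intro int_pow_mult_distrib) auto
  also have "\<dots> = b [^] (j + - j' * int p)"
    using f b j by (simp only: int_pow_pow int_pow_mult)
  also have "\<dots> = \<one>"
    using j' by (simp add: mult.commute)
  finally have "y \<in> generate G {a}"
    using ord_p_in_generate y by simp
  moreover have "1 < p ^ t"
    using Suc.prems(5) prime_gt_1_nat[OF prime] by (intro one_less_power) auto
  then have "b \<noteq> \<one>"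
    using Suc.prems(4) by auto
  ultimately have yb: "y \<in> generate G {b}"
    using socle[OF b] generate_singleton_trans[OF b] by blast
  have "f = y \<otimes> b [^] j'"
    unfolding y_def using f b by (simp add: m_assoc int_pow_neg)
  then show ?case
    using yb int_pow_in_generate[OF b] subgroup_generate_singleton[OF b] by (simp add: subgroup.m_closed)
qed

lemma commuting_comparable:
  assumes "f \<in> carrier G" "b \<in> carrier G" "f \<otimes> b = b \<otimes> f"
  shows "f \<in> generate G {b} \<or> b \<in> generate G {f}"
proof -
  obtain s t where "ord f = p ^ s" "ord b = p ^ t"
    using ord_prime_power assms by blast
  then show ?thesis
    using in_generate_if_ord_le[of f b s t] in_generate_if_ord_le[of b f t s] assms
    by (cases "s \<le> t") auto
qed

text \<open>Comparability leaves \<open>f = b [^] j\<close>, and an exponent \<open>j\<close> prime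
  to \<open>p\<close> would be invertible, making \<open>b\<close> a power of
  \<open>f\<close>.\<close>

lemma not_in_generate_imp_pow:
  assumes f: "f \<in> carrier G" and b: "b \<in> carrier G" and comm: "f \<otimes> b = b \<otimes> f"
    and nin: "b \<notin> generate G {f}"
  shows "f \<in> generate G {b [^] int p}"
proof -
  obtain j :: int where j: "f = b [^] j"
    using commuting_comparable[OF f b comm] nin b generate_singleton_iff by blast
  obtain t where t: "ord b = p ^ t"
    using ord_prime_power[OF b] by blast
  have "int p dvd j"
  proof (rule ccontr)
    assume "\<not> int p dvd j"
    then have "coprime (int (p ^ t)) j"
      using prime by (simp add: prime_imp_coprime)
    moreover have "b [^] int (p ^ t) = \<one>"
      using b t by (simp add: int_pow_eq_id)
    ultimately show False
      using generate_int_pow_coprime[OF b] nin j by blast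
  qed
  then obtain j' where "j = int p * j'"
    by (elim dvdE)
  then show ?thesis
    using j b generate_singleton_iff[of "b [^] int p"] by (auto simp: int_pow_pow)
qed

text \<open>Otherwise the order of \<open>b\<close>, a nontrivial power of \<open>p\<close>, would
  divide \<open>p * i - 1\<close> for some \<open>i\<close>.\<close>

lemma not_in_generate_pow:
  assumes b: "b \<in> carrier G" "b \<noteq> \<one>"
  shows "b \<notin> generate G {b [^] int p}"
proof
  assume "b \<in> generate G {b [^] int p}"
  then obtain i where "b = b [^] (int p * i)"
    using b generate_singleton_iff[of "b [^] int p"] by (auto simp: int_pow_pow)
  then have d: "int (ord b) dvd int p * i - 1"
    using b int_pow_eq[of b 1 "int p * i"] by simp
  obtain t where t: "ord b = p ^ t"
    using ord_prime_power[OF b(1)] by blast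
  with b have "t \<noteq> 0"
    using ord_eq_1 by (metis power_0)
  then have "int p dvd int (ord b)"
    using t by simp
  then have "int p dvd int p * i - 1"
    using d dvd_trans by blast
  then have "int p dvd 1"
    by (metis dvd_diff_right_iff dvd_triv_left)
  then show False
    using prime by simp
qed

end

text \<open>Reduces membership in \<open>Ksub\<close> of a countable group to finiteness of
  \<open>eta\<close>.\<close>

lemma countable_lesspoll_imp_finite:
  assumes "A \<prec> B" "countable B" 
  shows "finite A"
proof (rule ccontr)
  assume A: "infinite A"
  have sub: "A \<lesssim> B" and ne: "\<not> A \<approx> B"
    using assms by (auto simp: lesspoll_def)
  then have "countable A"
    using assms(2) countable_lepoll by blast
  moreover have "infinite B"
    using A sub by (meson inj_on_finite lepoll_def)
  ultimately have "A \<approx> (UNIV::nat set)" "B \<approx> (UNIV::nat set)"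
    using A assms(2) to_nat_on_infinite eqpoll_def by blast+
  then show False
    using ne eqpoll_sym eqpoll_trans by blast
qed

lemma (in group) generate_singleton_iso_integer_mod_group:
  assumes a: "a \<in> carrier G"
  shows "G\<lparr>carrier := generate G {a}\<rparr> \<cong> integer_mod_group (ord a)"
proof -
  let ?Z = "integer_mod_group (ord a)" and ?H = "G\<lparr>carrier := generate G {a}\<rparr>"
  have H: "group ?H"
    using subgroup_generate_singleton[OF a] subgroup_imp_group by blast
  \<comment> \<open>Addition in \<open>integer_mod_group\<close> reduces modulo
    \<open>ord a\<close>; for \<open>ord a = 0\<close> it is the group of integers and nothing is
    reduced.\<close>
  have pow_mod: "a [^] (i mod int (ord a)) = a [^] i" for i
    using a by (simp add: int_pow_eq mod_eq_dvd_iff[symmetric] dvd_minus_mod)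
  have "(\<lambda>i::int. a [^] i) \<in> hom ?Z ?H"
    by (rule homI) (auto simp: a int_pow_in_generate int_pow_mult pow_mod)
  moreover have "inj_on (\<lambda>i::int. a [^] i) (carrier ?Z)"
  proof (rule inj_onI)
    fix i j assume ij: "i \<in> carrier ?Z" "j \<in> carrier ?Z" "a [^] i = a [^] j"
    then have d: "int (ord a) dvd j - i"
      using a by (simp add: int_pow_eq)
    show "i = j"
    proof (cases "ord a = 0")
      case False
      have "j mod int (ord a) = i mod int (ord a)"
        using d by (simp add: mod_eq_dvd_iff)
      then show ?thesis
        using ij False by (simp add: carrier_integer_mod_group)
    qed (use d in simp)
  qed
  moreover have "(\<lambda>i::int. a [^] i) ` carrier ?Z = carrier ?H"
  proof
    show "carrier ?H \<subseteq> (\<lambda>i::int. a [^] i) ` carrier ?Z"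
    proof
      fix x assume "x \<in> carrier ?H"
      then obtain i :: int where "x = a [^] (i mod int (ord a))"
        using a pow_mod generate_singleton_iff by auto
      moreover have "i mod int (ord a) \<in> carrier ?Z"
        by (simp add: carrier_integer_mod_group)
      ultimately show "x \<in> (\<lambda>i::int. a [^] i) ` carrier ?Z"
        by blast
    qed
  qed (auto simp: a int_pow_in_generate)
  ultimately have "(\<lambda>i::int. a [^] i) \<in> iso ?Z ?H"
    by (auto simp: iso_def bij_betw_def)
  then show ?thesis
    using group.iso_set_sym[OF group_integer_mod_group] by (auto simp: is_iso_def)
qed

section \<open>The subgroup K of a group with a unique minimal subgroup\<close>

context prime_socle
begin

lemma eta_socle: "eta a G = {\<one>}"
proof -
  have "generate G {\<one>} = {\<one>}"
    using generate_one by simp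
  then show ?thesis
    using socle a_ne_one by (auto simp: eta_def)
qed

lemma p_group: "p_group p G"
  using ord_prime_power is_group by (auto simp: p_group_def)

lemma Ksub_eq_generate_socle:
  assumes inf: "infinite (carrier G)" and cnt: "countable (carrier G)"
    and K: "\<And>x. x \<in> carrier G \<Longrightarrow> finite (eta x G) \<Longrightarrow> x \<in> generate G {a}"
  shows "Ksub G = generate G {a}"
proof
  show "Ksub G \<subseteq> generate G {a}"
    using K countable_lesspoll_imp_finite[OF _ cnt] by (auto simp: Ksub_def)
  have "a \<in> Ksub G"
    using a_closed eta_socle inf by (simp add: Ksub_def finite_lesspoll_infinite)
  then show "generate G {a} \<subseteq> Ksub G"
    using subgroup_Ksub[OF inf] by (simp add: generate_subgroup_incl)
qed

end

section \<open>Quotients in terms of representatives\<close>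

context normal
begin

lemma rcos_eq_iff:
  assumes "x \<in> carrier G" "y \<in> carrier G"
  shows "H #> x = H #> y \<longleftrightarrow> x \<otimes> inv y \<in> H"
  using assms rcos_module[OF is_group, of y x] repr_independence[OF _ _ is_subgroup, of x y]
    rcos_self[OF _ is_subgroup, of x] by auto

lemma rcos_closed: "x \<in> carrier G \<Longrightarrow> H #> x \<in> carrier (G Mod H)"
  by (auto simp: carrier_FactGroup)

lemma rcos_in_generate_iff:
  assumes "x \<in> carrier G" "h \<in> carrier G"
  shows "H #> x \<in> generate (G Mod H) {H #> h} \<longleftrightarrow> (\<exists>i::int. h [^] i \<otimes> inv x \<in> H)"
proof -
  interpret Q: group "G Mod H"
    by (rule factorgroup_is_group)
  show ?thesis
    using assms rcos_eq_iff[OF int_pow_closed, of h x]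
    by (simp add: Q.generate_singleton_iff rcos_closed FactGroup_int_pow eq_commute[of "H #> x"])
qed

lemma rcos_eq_self_iff: "x \<in> carrier G \<Longrightarrow> H #> x = H \<longleftrightarrow> x \<in> H"
  using rcos_eq_iff[of x \<one>] by (simp add: subset coset_mult_one)

lemma infinite_FactGroup:
  assumes "infinite (carrier G)" "finite H"
  shows "infinite (carrier (G Mod H))"
proof
  assume "finite (carrier (G Mod H))"
  then have "finite (\<Union>(rcosets H))"
    using assms(2) rcosets_finite[OF _ subset] by (auto simp: FactGroup_def)
  then show False
    using assms(1) rcosets_part_G[OF is_subgroup] by simp
qed

lemma finite_vimage_rcos:
  assumes "finite H" "finite A" "A \<subseteq> carrier (G Mod H)"
  shows "finite {x \<in> carrier G. H #> x \<in> A}"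
proof (rule finite_subset)
  show "{x \<in> carrier G. H #> x \<in> A} \<subseteq> \<Union>A"
    using rcos_self[OF _ is_subgroup] by blast
  show "finite (\<Union>A)"
    using assms rcosets_finite[OF _ subset] by (auto simp: FactGroup_def)
qed

end

text \<open>Representative-level form of: the coset of \<open>a\<close> has order \<open>p\<close> in \<open>G Mod N\<close> and is a power of every
  nontrivial coset; \<open>tight_section\<close> adds that it generates \<open>Ksub (G Mod N)\<close>.\<close>

definition socle_section :: "nat \<Rightarrow> ('a, 'b) monoid_scheme \<Rightarrow> 'a set \<Rightarrow> 'a \<Rightarrow> bool" where
  "socle_section p G N a \<longleftrightarrow> N \<lhd> G \<and> finite N \<and> a \<in> carrier G \<and> a \<notin> N \<and> a [^]\<^bsub>G\<^esub> int p \<in> N \<and>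
     (\<forall>x\<in>carrier G - N. \<exists>i::int. x [^]\<^bsub>G\<^esub> i \<otimes>\<^bsub>G\<^esub> inv\<^bsub>G\<^esub> a \<in> N)"

definition tight_section :: "nat \<Rightarrow> ('a, 'b) monoid_scheme \<Rightarrow> 'a set \<Rightarrow> 'a \<Rightarrow> bool" where
  "tight_section p G N a \<longleftrightarrow> socle_section p G N a \<and>
     (\<forall>x\<in>carrier G. finite {h \<in> carrier G. \<forall>i::int. h [^]\<^bsub>G\<^esub> i \<otimes>\<^bsub>G\<^esub> inv\<^bsub>G\<^esub> x \<notin> N} \<longrightarrow>
       (\<exists>i::int. a [^]\<^bsub>G\<^esub> i \<otimes>\<^bsub>G\<^esub> inv\<^bsub>G\<^esub> x \<in> N))"

lemma socle_section_prime_socle: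
  fixes G :: "('a, 'b) monoid_scheme" (structure)
  assumes "prime p" "socle_section p G N a"
  shows "prime_socle (G Mod N) p (N #> a)"
proof -
  interpret normal N G
    using assms by (simp add: socle_section_def)
  interpret Q: group "G Mod N"
    by (rule factorgroup_is_group)
  have a: "a \<in> carrier G" "a \<notin> N" "a [^] int p \<in> N"
    using assms by (auto simp: socle_section_def)
  show ?thesis
  proof
    show "N #> a \<in> carrier (G Mod N)" "N #> a \<noteq> \<one>\<^bsub>G Mod N\<^esub>"
      "(N #> a) [^]\<^bsub>G Mod N\<^esub> int p = \<one>\<^bsub>G Mod N\<^esub>"
      using a rcos_eq_self_iff by (auto simp: rcos_closed FactGroup_int_pow)
  next
    fix X assume X: "X \<in> carrier (G Mod N)" "X \<noteq> \<one>\<^bsub>G Mod N\<^esub>"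
    then obtain x where x: "x \<in> carrier G" "X = N #> x"
      by (auto simp: carrier_FactGroup)
    then have "x \<notin> N"
      using X rcos_eq_self_iff by auto
    then show "N #> a \<in> generate (G Mod N) {X}"
      using x a assms rcos_in_generate_iff by (auto simp: socle_section_def)
  qed (fact assms(1))
qed

lemma tight_section_quotient:
  fixes G :: "('a, 'b) monoid_scheme" (structure)
  assumes p: "prime p" and tight: "tight_section p G N a"
    and inf: "infinite (carrier G)" and cnt: "countable (carrier G)"
  defines "H \<equiv> G Mod N"
  shows "infinite (carrier H) \<and> p_group p H \<and>
       (\<exists>a\<in>carrier H. Ksub H = generate H {a} \<and>
          H\<lparr>carrier := Ksub H\<rparr> \<cong> integer_mod_group p \<and>
          eta a H = {\<one>\<^bsub>H\<^esub>})"
proof -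
  have sec: "socle_section p G N a"
    and K: "\<And>x. x \<in> carrier G \<Longrightarrow> finite {h \<in> carrier G. \<forall>i::int. h [^] i \<otimes> inv x \<notin> N} \<Longrightarrow>
      \<exists>i::int. a [^] i \<otimes> inv x \<in> N"
    using tight by (auto simp: tight_section_def)
  interpret normal N G
    using sec by (simp add: socle_section_def)
  interpret Q: prime_socle "G Mod N" p "N #> a"
    by (rule socle_section_prime_socle[OF p sec])
  have fin: "finite N" and a: "a \<in> carrier G"
    using sec by (auto simp: socle_section_def)
  have inf': "infinite (carrier H)"
    unfolding H_def using infinite_FactGroup inf fin by blast
  have cnt': "countable (carrier H)"
    unfolding H_def carrier_FactGroup using cnt by simp
  have "Ksub H = generate H {N #> a}"
    unfolding H_def
  proof (rule Q.Ksub_eq_generate_socle)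
    fix X assume X: "X \<in> carrier (G Mod N)" "finite (eta X (G Mod N))"
    then obtain x where x: "x \<in> carrier G" "X = N #> x"
      by (auto simp: carrier_FactGroup)
    \<comment> \<open>As \<open>N\<close> is finite, a finite \<open>eta X\<close> in the quotient
      has a finite preimage, so the condition on representatives applies.\<close>
    have "{h \<in> carrier G. \<forall>i::int. h [^] i \<otimes> inv x \<notin> N}
        \<subseteq> {h \<in> carrier G. N #> h \<in> eta X (G Mod N)}"
      using x rcos_in_generate_iff rcos_closed by (auto simp: eta_def)
    moreover have "finite {h \<in> carrier G. N #> h \<in> eta X (G Mod N)}"
      using X(2) fin by (intro finite_vimage_rcos) (auto simp: eta_def)
    ultimately have "\<exists>i::int. a [^] i \<otimes> inv x \<in> N"
      using K x(1) finite_subset by blast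
    then show "X \<in> generate (G Mod N) {N #> a}"
      using x a rcos_in_generate_iff by blast
  qed (use inf' cnt' H_def in auto)
  moreover have "H\<lparr>carrier := generate H {N #> a}\<rparr> \<cong> integer_mod_group p"
    using Q.generate_singleton_iso_integer_mod_group[OF Q.a_closed] Q.ord_a by (simp add: H_def)
  ultimately show ?thesis
    using inf' Q.p_group Q.eta_socle Q.a_closed unfolding H_def by auto
qed

section \<open>The centre\<close>

definition center :: "('a, 'b) monoid_scheme \<Rightarrow> 'a set" where
  "center G = {z \<in> carrier G. \<forall>x\<in>carrier G. z \<otimes>\<^bsub>G\<^esub> x = x \<otimes>\<^bsub>G\<^esub> z}"

lemma center_closed: "z \<in> center G \<Longrightarrow> z \<in> carrier G"
  by (simp add: center_def)

lemma center_commute: "z \<in> center G \<Longrightarrow> x \<in> carrier G \<Longrightarrow> z \<otimes>\<^bsub>G\<^esub> x = x \<otimes>\<^bsub>G\<^esub> z"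
  by (simp add: center_def)

lemma (in group) generate_subset_center:
  assumes "z \<in> center G" "x \<in> generate G {z}"
  shows "x \<in> center G"
  using assms generate_singleton_commute[OF assms(2)] generate_singleton_closed[of z x]
  unfolding center_def by blast

context prime_socle
begin

lemma socle_in_center: "a \<in> center G"
proof -
  have "a \<otimes> x = x \<otimes> a" if "x \<in> carrier G" for x
    using that a_closed generate_singleton_commute[OF socle[OF that], of x] by (cases "x = \<one>") auto
  then show ?thesis
    using a_closed by (simp add: center_def)
qed

text \<open>Take \<open>b\<close> of maximal order in the centre. A central \<open>c\<close> is
  comparable to \<open>b\<close>, and if \<open>b\<close> is a power of \<open>c\<close>, maximality
  makes the two cyclic subgroups equal.\<close>

lemma finite_center_cyclic:
  assumes "finite (center G)"
  obtains b where "b \<in> center G" "b \<noteq> \<one>" "center G \<subseteq> generate G {b}"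
proof -
  have "ord ` center G \<noteq> {}"
    using socle_in_center by blast
  then have "Max (ord ` center G) \<in> ord ` center G"
    using assms by simp
  then obtain b where b: "b \<in> center G" "ord b = Max (ord ` center G)"
    by auto
  have bc: "b \<in> carrier G"
    using b by (simp add: center_def)
  have sub: "c \<in> generate G {b}" if c: "c \<in> center G" for c
  proof -
    have cc: "c \<in> carrier G" "c \<otimes> b = b \<otimes> c"
      using c bc by (blast dest: center_closed center_commute)+
    consider "c \<in> generate G {b}" | "b \<in> generate G {c}"
      using commuting_comparable[OF cc(1) bc cc(2)] by blast
    then show ?thesis
    proof cases
      case 2
      have "generate G {b} \<subseteq> generate G {c}"
        using 2 cc generate_singleton_trans by blast
      moreover have "card (generate G {c}) \<le> card (generate G {b})"
        using b c assms bc cc generate_pow_card by (metis Max_ge finite_imageI image_eqI)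
      ultimately have "generate G {b} = generate G {c}"
        using card_seteq finite_generate_singleton[OF cc(1) ord_ne_0] cc(1) by blast
      then show ?thesis
        using cc generate_singleton_self by blast
    qed
  qed
  moreover have "b \<noteq> \<one>"
    using sub[OF socle_in_center] a_ne_one generate_one by auto
  ultimately show ?thesis
    using that b by blast
qed

lemma finite_eta_in_center:
  assumes "infinite (carrier G)" "x \<in> carrier G" "finite (eta x G)"
  shows "x \<in> center G"
  unfolding center_def using assms finite_eta_imp_central by blast

text \<open>A non-central \<open>x\<close> is not a power of any central element, so by
  comparability every central element is a power of \<open>x\<close>. This would confine the
  infinite centre to a finite cyclic group.\<close>

lemma infinite_center_commute:
  assumes inf: "infinite (center G)" and x: "x \<in> carrier G" and y: "y \<in> carrier G"
  shows "x \<otimes> y = y \<otimes> x"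
proof -
  have "x \<in> center G"
  proof (rule ccontr)
    assume "x \<notin> center G"
    have "z \<in> generate G {x}" if "z \<in> center G" for z
      using that commuting_comparable[OF x center_closed[OF that] center_commute[OF that x, symmetric]]
        generate_subset_center[OF that] \<open>x \<notin> center G\<close> by blast
    then have "center G \<subseteq> generate G {x}"
      by blast
    then show False
      using inf finite_subset[OF _ finite_generate_singleton[OF x ord_ne_0[OF x]]] by simp
  qed
  then show ?thesis
    by (rule center_commute[OF _ y])
qed

text \<open>Some central \<open>c\<close> lies outside the finite group generated by
  \<open>x\<close>, so \<open>x\<close> is a power of \<open>c [^] p\<close> and has a
  \<open>p\<close>-th root.\<close>

lemma infinite_center_divisible:
  assumes inf: "infinite (center G)" and x: "x \<in> carrier G" and m: "m > 0"
  shows "\<exists>y\<in>carrier G. x = y [^] int m"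
proof -
  have p_div: "\<exists>y\<in>carrier G. x = y [^] int p" if x: "x \<in> carrier G" for x
  proof -
    have "\<not> center G \<subseteq> generate G {x}"
      using inf finite_subset[OF _ finite_generate_singleton[OF x ord_ne_0[OF x]]] by blast
    then obtain c where "c \<in> center G" and c': "c \<notin> generate G {x}"
      by blast
    then have c: "c \<in> carrier G"
      by (simp add: center_closed)
    have "x \<in> generate G {c [^] int p}"
      using not_in_generate_imp_pow[OF x c infinite_center_commute[OF inf x c] c'] .
    then obtain i :: int where "x = (c [^] int p) [^] i"
      using c generate_singleton_iff[of "c [^] int p"] by auto
    then have "x = (c [^] i) [^] int p"
      using c by (simp add: int_pow_pow mult.commute)
    then show ?thesis
      using c by (intro bexI[of _ "c [^] i"]) auto
  qed
  have pow_div: "\<exists>y\<in>carrier G. x = y [^] int (p ^ s)" if "x \<in> carrier G" for x s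
    using that
  proof (induction s arbitrary: x)
    case 0
    then show ?case by (auto intro: bexI[of _ x])
  next
    case (Suc s)
    obtain y where y: "y \<in> carrier G" "x = y [^] int p"
      using p_div Suc by blast
    obtain z where z: "z \<in> carrier G" "y = z [^] int (p ^ s)"
      using Suc.IH y by blast
    have "x = z [^] int (p ^ Suc s)"
      using y z by (simp add: int_pow_pow mult.commute)
    then show ?case
      using z by blast
  qed
  \<comment> \<open>The \<open>p\<close>-part of \<open>m\<close> is handled by iterated
    \<open>p\<close>-th roots; the remaining factor \<open>r\<close> is invertible modulo the order
    of the root.\<close>
  obtain r where r: "m = p ^ multiplicity p m * r" "\<not> p dvd r"
    using multiplicity_decompose'[of m p] m prime not_prime_unit by blast
  obtain y where y: "y \<in> carrier G" "x = y [^] int (p ^ multiplicity p m)"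
    using pow_div x by blast
  obtain t where t: "ord y = p ^ t"
    using ord_prime_power y by blast
  have "coprime (int (p ^ t)) (int r)"
    using r prime by (simp add: prime_imp_coprime)
  moreover have "y [^] int (p ^ t) = \<one>"
    using y t by (simp add: int_pow_eq_id)
  ultimately have "y \<in> generate G {y [^] int r}"
    using generate_int_pow_coprime y by blast
  then obtain i :: int where "y = y [^] (int r * i)"
    using y generate_singleton_iff[of "y [^] int r"] by (auto simp: int_pow_pow)
  then have "x = (y [^] (int r * i)) [^] int (p ^ multiplicity p m)"
    using y by simp
  also have "\<dots> = (y [^] i) [^] int m"
    using y(1) by (subst (2) r(1)) (simp add: int_pow_pow ac_simps)
  finally show ?thesis
    using y by blast
qed

end

text \<open>Enlarging \<open>N\<close> by the preimage of the \<open>p\<close>-th powers of the centre of \<open>G Mod N\<close> keeps the socle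
  property, since every coset either has a generator \<open>b\<close> of the centre as a power or is a power of
  \<open>b [^] p\<close>.\<close>

lemma finite_center_socle_section:
  fixes G :: "('a, 'b) monoid_scheme" (structure)
  assumes p: "prime p" and sec: "socle_section p G N a" and inf: "infinite (carrier G)"
    and fin: "finite (center (G Mod N))"
  obtains M b where "tight_section p G M b"
proof -
  interpret normal N G
    using sec by (simp add: socle_section_def)
  interpret Q: prime_socle "G Mod N" p "N #> a"
    by (rule socle_section_prime_socle[OF p sec])
  have finN: "finite N"
    using sec by (simp add: socle_section_def)
  have infQ: "infinite (carrier (G Mod N))"
    by (rule infinite_FactGroup[OF inf finN])
  obtain B where B: "B \<in> center (G Mod N)" "B \<noteq> \<one>\<^bsub>G Mod N\<^esub>" "center (G Mod N) \<subseteq> generate (G Mod N) {B}"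
    using Q.finite_center_cyclic[OF fin] .
  have Bc: "B \<in> carrier (G Mod N)"
    using B by (simp add: center_def)
  obtain b where b: "b \<in> carrier G" "B = N #> b"
    using Bc by (auto simp: carrier_FactGroup)
  define P where "P = generate (G Mod N) {B [^]\<^bsub>G Mod N\<^esub> int p}"
  have P_sub: "subgroup P (G Mod N)"
    unfolding P_def using Bc by (simp add: Q.subgroup_generate_singleton)
  have P_center: "X \<in> center (G Mod N)" if "X \<in> P" for X
    using that B(1) Q.generate_subset_center Q.int_pow_in_generate[OF Bc] Bc unfolding P_def by blast
  have P_fin: "finite P"
    unfolding P_def using Bc by (simp add: Q.finite_generate_singleton Q.ord_ne_0)
  define M where "M = {x \<in> carrier G. N #> x \<in> P}"
  have N_M: "N \<subseteq> M"
  proof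
    fix x assume "x \<in> N"
    then have "x \<in> carrier G" "N #> x = N"
      using subset rcos_eq_self_iff by auto
    then show "x \<in> M"
      using subgroup.one_closed[OF P_sub] by (simp add: M_def)
  qed
  have dichotomy: "B \<in> generate (G Mod N) {X}" if "X \<in> carrier (G Mod N)" "X \<notin> P" for X
    using that Q.not_in_generate_imp_pow[OF that(1) Bc] center_commute[OF B(1) that(1)]
    by (auto simp: P_def)
  have inv_rcos: "inv\<^bsub>G Mod N\<^esub> (N #> x) = N #> inv x" if "x \<in> carrier G" for x
    using FactGroup_int_pow[OF that, of "-1"] that rcos_closed
    by (simp add: Q.int_pow_neg int_pow_neg)
  have M_sub: "subgroup M G"
  proof (rule subgroupI)
    show "M \<noteq> {}"
      using N_M subgroup.one_closed[OF is_subgroup] by blast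
  next
    fix x assume "x \<in> M"
    then show "inv x \<in> M"
      using subgroup.m_inv_closed[OF P_sub, of "N #> x"] by (simp add: M_def inv_rcos)
  next
    fix x y assume "x \<in> M" "y \<in> M"
    then show "x \<otimes> y \<in> M"
      using subgroup.m_closed[OF P_sub, of "N #> x" "N #> y"] by (simp add: M_def rcos_sum)
  qed (auto simp: M_def)
  have M_normal: "M \<lhd> G"
  proof (rule normal_invI[OF M_sub])
    fix x h assume x: "x \<in> carrier G" and h: "h \<in> M"
    then have hc: "h \<in> carrier G" "N #> h \<in> center (G Mod N)"
      using P_center by (auto simp: M_def)
    have "N #> (x \<otimes> h \<otimes> inv x) = (N #> x) \<otimes>\<^bsub>G Mod N\<^esub> (N #> h) \<otimes>\<^bsub>G Mod N\<^esub> (N #> inv x)"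
      using x hc by (simp add: rcos_sum)
    also have "\<dots> = (N #> h) \<otimes>\<^bsub>G Mod N\<^esub> (N #> x) \<otimes>\<^bsub>G Mod N\<^esub> (N #> inv x)"
      using center_commute[OF hc(2) rcos_closed[OF x]] by simp
    also have "\<dots> = N #> (h \<otimes> x \<otimes> inv x)"
      using x hc by (simp add: rcos_sum)
    finally show "x \<otimes> h \<otimes> inv x \<in> M"
      using x hc h by (simp add: M_def m_assoc)
  qed
  have M_fin: "finite M"
    unfolding M_def using finite_vimage_rcos[OF finN P_fin subgroup.subset[OF P_sub]] .
  have "socle_section p G M b"
    unfolding socle_section_def
  proof (intro conjI ballI)
    show "b \<notin> M"
      using b Q.not_in_generate_pow[OF Bc B(2)] by (simp add: M_def P_def)
    show "b [^] int p \<in> M"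
      using b Q.generate_singleton_self[OF rcos_closed[of "b [^] int p"]]
      by (simp add: M_def P_def FactGroup_int_pow)
  next
    fix x assume x: "x \<in> carrier G - M"
    then have "B \<in> generate (G Mod N) {N #> x}"
      using dichotomy rcos_closed by (simp add: M_def)
    then show "\<exists>i::int. x [^] i \<otimes> inv b \<in> M"
      using x b rcos_in_generate_iff N_M by blast
  qed (use M_normal M_fin b in auto)
  moreover have "\<exists>i::int. b [^] i \<otimes> inv x \<in> M"
    if x: "x \<in> carrier G" and finx: "finite {h \<in> carrier G. \<forall>i::int. h [^] i \<otimes> inv x \<notin> M}" for x
  proof -
    \<comment> \<open>If \<open>h\<close> lies outside \<open>M\<close>, its coset has
      \<open>B\<close>, hence all of \<open>P\<close>, among its powers. A product
      \<open>h [^] i \<otimes> inv x\<close> in \<open>M\<close> would then make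
      \<open>N #> x\<close> a power of \<open>N #> h\<close>.\<close>
    have "eta (N #> x) (G Mod N) \<subseteq>
      (\<lambda>h. N #> h) ` ({h \<in> carrier G. \<forall>i::int. h [^] i \<otimes> inv x \<notin> M} \<union> M)"
    proof
      fix Y assume Y: "Y \<in> eta (N #> x) (G Mod N)"
      then obtain h where h: "h \<in> carrier G" "Y = N #> h" "N #> x \<notin> generate (G Mod N) {N #> h}"
        by (auto simp: eta_def carrier_FactGroup)
      have "h [^] i \<otimes> inv x \<notin> M" if hM: "h \<notin> M" for i :: int
      proof
        let ?S = "generate (G Mod N) {N #> h}"
        assume "h [^] i \<otimes> inv x \<in> M"
        then have "N #> (h [^] i \<otimes> inv x) \<in> P"
          by (simp add: M_def)
        moreover have "B \<in> ?S"
          using dichotomy hM h rcos_closed by (simp add: M_def)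
        then have "P \<subseteq> ?S"
          unfolding P_def using Q.int_pow_in_generate[OF Bc] Q.generate_singleton_trans h rcos_closed by blast
        moreover have S: "subgroup ?S (G Mod N)"
          using h rcos_closed by (simp add: Q.subgroup_generate_singleton)
        moreover have "N #> (h [^] (- i)) \<in> ?S"
          using Q.int_pow_in_generate[OF rcos_closed[OF h(1)], of "-i"] h by (simp add: FactGroup_int_pow)
        ultimately have "(N #> h [^] (- i)) \<otimes>\<^bsub>G Mod N\<^esub> (N #> (h [^] i \<otimes> inv x)) \<in> ?S"
          using subgroup.m_closed[OF S] by blast
        then have "N #> inv x \<in> ?S"
          using h x by (simp add: rcos_sum int_pow_neg m_assoc[symmetric])
        then have "inv\<^bsub>G Mod N\<^esub> (N #> inv x) \<in> ?S"
          using subgroup.m_inv_closed[OF S] by blast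
        then show False
          using h x by (simp add: inv_rcos)
      qed
      then show "Y \<in> (\<lambda>h. N #> h) ` ({h \<in> carrier G. \<forall>i::int. h [^] i \<otimes> inv x \<notin> M} \<union> M)"
        using h by blast
    qed
    then have "finite (eta (N #> x) (G Mod N))"
      by (rule finite_surj[rotated]) (use finx M_fin in simp)
    \<comment> \<open>An element with finite \<open>eta\<close> is central in the quotient, and
      \<open>B\<close> generates the centre.\<close>
    then have "N #> x \<in> generate (G Mod N) {B}"
      using Q.finite_eta_in_center[OF infQ] B(3) rcos_closed[OF x] by blast
    then show ?thesis
      using x b rcos_in_generate_iff N_M by blast
  qed
  ultimately show ?thesis
    using that unfolding tight_section_def by blast
qed

section \<open>Divisible normal chains of finite index\<close>

text \<open>\<open>D\<close> is a Pruefer group, described by divisibility and by comparability of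
  its elements. For countable \<open>G\<close>, \<open>D_eta\<close> says that \<open>D\<close> is
  not contained in \<open>Ksub G\<close>.\<close>

locale divisible_chain = group G for G (structure) +
  fixes D and k and p n :: nat
  assumes D_normal: "D \<lhd> G"
    and D_infinite: "infinite D"
    and D_chain: "\<lbrakk>x \<in> D; y \<in> D\<rbrakk> \<Longrightarrow> x \<in> generate G {y} \<or> y \<in> generate G {x}"
    and D_divisible: "\<lbrakk>x \<in> D; m > 0\<rbrakk> \<Longrightarrow> \<exists>y\<in>D. x = y [^] int m"
    and D_index: "finite (rcosets D)"
    and torsion: "x \<in> carrier G \<Longrightarrow> ord x \<noteq> 0"
    and prime: "prime p"
    and k_in_D: "k \<in> D" and ord_k: "ord k = p ^ n" and n_pos: "n \<ge> 1"
    and k_central: "x \<in> carrier G \<Longrightarrow> k \<otimes> x = x \<otimes> k"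
    and k_eta: "finite (eta k G)"
    and D_eta: "\<exists>x\<in>D. infinite (eta x G)"
begin

lemma D_sub: "subgroup D G"
  using D_normal normal_imp_subgroup by blast

lemma D_closed: "d \<in> D \<Longrightarrow> d \<in> carrier G"
  using subgroup.subset[OF D_sub] by blast

lemma k_closed: "k \<in> carrier G"
  using k_in_D D_closed by blast

lemma k_ne_one: "k \<noteq> \<one>"
  using ord_k n_pos prime_gt_1_nat[OF prime] one_less_power[of p n] by auto

lemma D_commute:
  assumes "x \<in> D" "y \<in> D"
  shows "x \<otimes> y = y \<otimes> x"
  using D_chain[OF assms]
proof
  assume "x \<in> generate G {y}"
  then show ?thesis
    using generate_singleton_commute[of x y y] assms D_closed by blast
next
  assume "y \<in> generate G {x}"
  then show ?thesis
    using generate_singleton_commute[of y x x] assms D_closed by metis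
qed

text \<open>Let \<open>c\<close> in \<open>D\<close> be an \<open>m\<close>-th root of
  \<open>k\<close>. An \<open>x\<close> killed by \<open>m\<close> cannot have \<open>c\<close> as a
  power, since \<open>k\<close> is nontrivial, so \<open>x\<close> lies in the finite group
  generated by \<open>c\<close>.\<close>

lemma finite_D_torsion:
  assumes "m > 0"
  shows "finite {x \<in> D. x [^] int m = \<one>}"
proof -
  obtain c where c: "c \<in> D" "k = c [^] int m"
    using D_divisible[OF k_in_D assms] by blast
  have "{x \<in> D. x [^] int m = \<one>} \<subseteq> generate G {c}"
  proof clarify
    fix x assume x: "x \<in> D" "x [^] int m = \<one>"
    have "c \<notin> generate G {x}"
    proof
      assume "c \<in> generate G {x}"
      then obtain i :: int where "c = x [^] i"
        using x D_closed generate_singleton_iff by blast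
      then have "c [^] int m = (x [^] int m) [^] i"
        using D_closed[OF x(1)] by (simp only: int_pow_pow mult.commute)
      then show False
        using x(2) c(2) k_ne_one by simp
    qed
    then show "x \<in> generate G {c}"
      using D_chain[OF x(1) c(1)] by blast
  qed
  moreover have "finite (generate G {c})"
    using c(1) D_closed torsion finite_generate_singleton by blast
  ultimately show ?thesis
    by (rule finite_subset)
qed

abbreviation ZD where "ZD \<equiv> {x \<in> carrier G. \<forall>d\<in>D. x \<otimes> d = d \<otimes> x}"

lemma ZD_sub: "subgroup ZD G"
  using subgroup_commuting subgroup.subset[OF D_sub] by blast

text \<open>By finite index, an infinite set of this kind would meet one coset of \<open>D\<close>
  infinitely often. Two such elements in one coset differ by an element of \<open>D\<close> killed
  by \<open>m\<close>, because they centralise \<open>D\<close>.\<close>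

lemma finite_ZD_torsion:
  assumes "m > 0"
  shows "finite {h \<in> ZD. h [^] int m = \<one>}" (is "finite ?S")
proof (rule ccontr)
  assume inf: "infinite ?S"
  have "(\<lambda>h. D #> h) ` ?S \<subseteq> rcosets D"
    by (auto simp: RCOSETS_def)
  then have "finite ((\<lambda>h. D #> h) ` ?S)"
    using D_index finite_subset by blast
  then obtain h0 where h0: "h0 \<in> ?S" "infinite {h \<in> ?S. D #> h = D #> h0}"
    using pigeonhole_infinite[OF inf] by blast
  have "{h \<in> ?S. D #> h = D #> h0} \<subseteq> (\<lambda>d. d \<otimes> h0) ` {x \<in> D. x [^] int m = \<one>}"
  proof
    fix h assume h: "h \<in> {h \<in> ?S. D #> h = D #> h0}"
    then have hc: "h \<in> carrier G" "h0 \<in> carrier G"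
      using h0 by auto
    then have "h \<in> D #> h0"
      using h rcos_self[OF _ D_sub] by blast
    then obtain d where d: "d \<in> D" "h = d \<otimes> h0"
      by (auto simp: r_coset_def)
    then have "h [^] int m = d [^] int m \<otimes> h0 [^] int m"
      using int_pow_mult_distrib[of d h0] h0 D_closed by auto
    then have "d [^] int m = \<one>"
      using h h0 d D_closed by auto
    then show "h \<in> (\<lambda>d. d \<otimes> h0) ` {x \<in> D. x [^] int m = \<one>}"
      using d by blast
  qed
  then show False
    using h0(2) finite_D_torsion[OF assms] finite_surj by blast
qed

text \<open>Let \<open>r\<close> be the index of the supposedly central \<open>D\<close>. For
  \<open>x\<close> in \<open>D\<close> and \<open>h\<close> in \<open>eta x G\<close>, comparability
  makes \<open>h [^] r\<close> a power of \<open>x\<close>, so \<open>h\<close> is killed by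
  \<open>r * ord x\<close>. Then every such \<open>eta x G\<close> would be finite.\<close>

lemma D_not_central: "ZD \<noteq> carrier G"
proof
  assume Z: "ZD = carrier G"
  interpret N: normal D G by (rule D_normal)
  interpret Q: group "G Mod D" by (rule N.factorgroup_is_group)
  define r where "r = order (G Mod D)"
  have r: "r > 0"
    using D_index Q.order_gt_0_iff_finite by (simp add: r_def FactGroup_def)
  have pow_r: "h [^] int r \<in> D" if h: "h \<in> carrier G" for h
  proof -
    have "(D #> h) [^]\<^bsub>G Mod D\<^esub> r = \<one>\<^bsub>G Mod D\<^esub>"
      unfolding r_def using h by (intro Q.pow_order_eq_1) (rule N.rcos_closed)
    then show ?thesis
      using h N.rcos_eq_self_iff[of "h [^] r"] by (simp add: N.FactGroup_pow int_pow_int)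
  qed
  obtain x where x: "x \<in> D" "infinite (eta x G)"
    using D_eta by blast
  have xc: "x \<in> carrier G"
    using x D_closed by blast
  have "eta x G \<subseteq> {h \<in> ZD. h [^] int (r * ord x) = \<one>}"
  proof
    fix h assume "h \<in> eta x G"
    then have h: "h \<in> carrier G" "x \<notin> generate G {h}"
      by (auto simp: eta_def)
    have "x \<notin> generate G {h [^] int r}"
      using h generate_singleton_trans[OF h(1) int_pow_in_generate[OF h(1)]] by blast
    then have "h [^] int r \<in> generate G {x}"
      using D_chain[OF x(1) pow_r[OF h(1)]] by blast
    then obtain i :: int where i: "h [^] int r = x [^] i"
      using generate_singleton_iff[OF xc] by blast
    have "h [^] int (r * ord x) = (h [^] int r) [^] int (ord x)"
      using h by (simp add: int_pow_pow)
    also have "\<dots> = \<one>"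
      unfolding i using xc by (simp add: int_pow_pow int_pow_eq_id)
    finally show "h \<in> {h \<in> ZD. h [^] int (r * ord x) = \<one>}"
      using h Z by blast
  qed
  moreover have "r * ord x > 0"
    using r torsion[OF xc] by simp
  ultimately show False
    using x(2) finite_ZD_torsion finite_subset by blast
qed

lemma conj_in_D: "c \<in> carrier G \<Longrightarrow> d \<in> D \<Longrightarrow> c \<otimes> d \<otimes> inv c \<in> D"
  using D_normal normal_invE(2) by blast

text \<open>The map \<open>c \<mapsto> c \<otimes> g \<otimes> inv c \<otimes> inv g\<close> is a nontrivial endomorphism of the divisible group \<open>D\<close>,
  hence has an infinite image and so, as \<open>D\<close> is a chain, is onto.\<close>

lemma coset_conjugate:
  assumes g: "g \<in> carrier G" "g \<notin> ZD" and y: "y \<in> D"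
  obtains c where "c \<in> D" "y \<otimes> g = c \<otimes> g \<otimes> inv c"
proof -
  define f where "f c = c \<otimes> (g \<otimes> inv c \<otimes> inv g)" for c
  let ?D = "G\<lparr>carrier := D\<rparr>"
  have D: "group ?D"
    using D_sub subgroup_imp_group by blast
  have f_D: "f c \<in> D" if "c \<in> D" for c
    unfolding f_def using that conj_in_D g D_sub by (simp add: subgroup.m_closed subgroup.m_inv_closed)
  have f_hom: "f \<in> hom ?D G"
  proof (rule homI)
    fix c e assume ce: "c \<in> carrier ?D" "e \<in> carrier ?D"
    then have cl: "c \<in> carrier G" "e \<in> carrier G"
      using D_closed by auto
    have gD: "g \<otimes> inv c \<otimes> inv g \<in> D" "g \<otimes> inv e \<otimes> inv g \<in> D"
      using ce conj_in_D g D_sub by (auto simp: subgroup.m_inv_closed)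
    have "f (c \<otimes> e) = c \<otimes> e \<otimes> (g \<otimes> inv e \<otimes> inv g \<otimes> (g \<otimes> inv c \<otimes> inv g))"
      unfolding f_def using cl g by (simp add: inv_mult_group m_assoc inv_cancel_left)
    also have "\<dots> = c \<otimes> (e \<otimes> (g \<otimes> inv e \<otimes> inv g) \<otimes> (g \<otimes> inv c \<otimes> inv g))"
      using cl g by (simp add: m_assoc)
    also have "e \<otimes> (g \<otimes> inv e \<otimes> inv g) \<otimes> (g \<otimes> inv c \<otimes> inv g)
        = (g \<otimes> inv c \<otimes> inv g) \<otimes> (e \<otimes> (g \<otimes> inv e \<otimes> inv g))"
      using ce gD D_sub by (intro D_commute) (auto simp: subgroup.m_closed)
    finally show "f (c \<otimes>\<^bsub>?D\<^esub> e) = f c \<otimes> f e"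
      unfolding f_def using cl g by (simp add: m_assoc)
  qed (use f_D D_closed in auto)
  interpret f: group_hom ?D G f
    using D f_hom is_group by (simp add: group_hom_def group_hom_axioms_def)
  have img: "subgroup (f ` D) G"
    using f.img_is_subgroup by simp
  have "y \<in> f ` D"
  proof (rule ccontr)
    assume "y \<notin> f ` D"
    then have all: "f c \<in> generate G {y}" if "c \<in> D" for c
      using that D_chain[OF f_D[OF that] y] generate_singleton_in_subgroup[OF img] by blast
    obtain c where c: "c \<in> D" "g \<otimes> c \<noteq> c \<otimes> g"
      using g by blast
    have yc: "y \<in> carrier G"
      using y D_closed by blast
    \<comment> \<open>If the image lay in \<open>generate G {y}\<close>, an \<open>ord y\<close>-th
      root \<open>e\<close> of \<open>c\<close> would give
      \<open>f c = f e [^] ord y = \<one>\<close>, so \<open>g\<close> would commute with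
      \<open>c\<close>.\<close>
    obtain e where e: "e \<in> D" "c = e [^] int (ord y)"
      using D_divisible[OF c(1)] torsion[OF yc] by blast
    obtain i :: int where i: "f e = y [^] i"
      using all[OF e(1)] generate_singleton_iff[OF yc] by blast
    have "f c = f e [^] int (ord y)"
      unfolding e(2) using f.hom_int_pow[of e "int (ord y)"] e(1) int_pow_consistent[OF D_sub e(1)] by simp
    also have "\<dots> = \<one>"
      unfolding i using yc by (simp add: int_pow_pow int_pow_eq_id)
    finally have "c \<otimes> (g \<otimes> inv c \<otimes> inv g) = \<one>"
      by (simp add: f_def)
    moreover have "c \<otimes> g = c \<otimes> (g \<otimes> inv c \<otimes> inv g) \<otimes> (g \<otimes> c)"
      using D_closed[OF c(1)] g(1) by (simp add: m_assoc inv_cancel_left)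
    ultimately have "c \<otimes> g = g \<otimes> c"
      using D_closed[OF c(1)] g(1) by simp
    then show False
      using c by simp
  qed
  then obtain c where c: "c \<in> D" "y = f c"
    by blast
  have "y \<otimes> g = c \<otimes> g \<otimes> inv c"
    unfolding c(2) f_def using D_closed[OF c(1)] g(1) by (simp add: m_assoc)
  then show ?thesis
    using that c by blast
qed

text \<open>The infinite coset \<open>D #> g\<close> is not inside the finite
  \<open>eta k G\<close>, so some element of it has \<open>k\<close> as a power. That element is
  conjugate to \<open>g\<close>, and \<open>k\<close> is central.\<close>

lemma k_in_generate:
  assumes g: "g \<in> carrier G" "g \<notin> ZD"
  shows "k \<in> generate G {g}"
proof -
  have "inj_on (\<lambda>d. d \<otimes> g) D"
    using inj_on_multc[OF g(1)] inj_on_subset subgroup.subset[OF D_sub] by blast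
  then have "infinite ((\<lambda>d. d \<otimes> g) ` D)"
    using D_infinite finite_imageD by blast
  then have "\<not> (\<lambda>d. d \<otimes> g) ` D \<subseteq> eta k G"
    using k_eta finite_subset by blast
  then obtain d where d: "d \<in> D" "d \<otimes> g \<notin> eta k G"
    by blast
  then have "k \<in> generate G {d \<otimes> g}"
    using g(1) D_closed[OF d(1)] by (simp add: eta_def)
  moreover obtain c where c: "c \<in> D" "d \<otimes> g = c \<otimes> g \<otimes> inv c"
    using coset_conjugate[OF g d(1)] .
  moreover have cc: "c \<in> carrier G"
    using c D_closed by blast
  ultimately show ?thesis
    using central_in_generate_conjugate[OF k_closed k_central[OF cc] cc g(1)] by simp
qed

text \<open>Choose \<open>g\<close> of least order outside \<open>ZD\<close>; then
  \<open>g [^] q\<close> is in \<open>ZD\<close> for each prime \<open>q\<close> dividing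
  \<open>ord g\<close>. One such prime is \<open>p\<close>, as \<open>k\<close> is a power of
  \<open>g\<close>, and a second one would put \<open>g\<close> itself into \<open>ZD\<close> by
  Bezout.\<close>

lemma obtain_minimal_noncentralizing:
  obtains g t where "g \<in> carrier G" "g \<notin> ZD" "ord g = p ^ t" "g [^] int p \<in> ZD"
proof -
  have "\<exists>g. g \<in> carrier G - ZD"
    using D_not_central by blast
  then obtain g where g: "g \<in> carrier G - ZD"
    and least: "\<And>h. h \<in> carrier G - ZD \<Longrightarrow> ord g \<le> ord h"
    using ex_has_least_nat[of "\<lambda>g. g \<in> carrier G - ZD" _ ord] by blast
  have gc: "g \<in> carrier G" "g \<notin> ZD"
    using g by auto
  have pow: "g [^] int q \<in> ZD" if q: "prime q" "q dvd ord g" for q :: nat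
  proof (rule ccontr)
    assume "g [^] int q \<notin> ZD"
    then have "ord g \<le> ord (g [^] q)"
      using least gc by (simp add: int_pow_int)
    also have "\<dots> = ord g div q"
      using q gc prime_gt_0_nat by (intro ord_pow) auto
    also have "\<dots> < ord g"
      using torsion[OF gc(1)] prime_gt_1_nat[OF q(1)] by (intro div_less_dividend) auto
    finally show False
      by simp
  qed
  obtain i :: int where i: "k = g [^] i"
    using k_in_generate[OF gc] generate_singleton_iff[OF gc(1)] by blast
  have "k [^] int (ord g) = \<one>"
    unfolding i using gc by (simp add: int_pow_pow int_pow_eq_id)
  then have "p ^ n dvd ord g"
    unfolding int_pow_eq_id[OF k_closed] ord_k int_dvd_int_iff .
  then have p: "p dvd ord g"
    using n_pos by (meson dvd_power dvd_trans less_le_trans zero_less_one)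
  have uniq: "q = p" if q: "prime q" "q dvd ord g" for q
  proof (rule ccontr)
    assume "q \<noteq> p"
    then have "coprime (int q) (int p)"
      using q prime primes_coprime by simp
    then obtain u v where uv: "u * int q + v * int p = 1"
      using bezout_int[of "int q" "int p"] by (metis coprime_imp_gcd_eq_1)
    have "(g [^] int q) [^] u \<otimes> (g [^] int p) [^] v \<in> ZD"
      by (intro subgroup.m_closed[OF ZD_sub] subgroup_int_pow_closed[OF ZD_sub] pow q prime p)
    also have "(g [^] int q) [^] u \<otimes> (g [^] int p) [^] v = g [^] (u * int q + v * int p)"
      using gc(1) by (simp add: int_pow_pow int_pow_mult mult.commute)
    finally show False
      unfolding uv using gc by simp
  qed
  have "\<exists>t. ord g = p ^ t"
    using nat_prime_power_if_unique_prime[OF torsion[OF gc(1)] prime uniq] .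
  then show ?thesis
    using that gc pow[OF prime p] by blast
qed

text \<open>\<open>d \<otimes> g\<close> is the conjugate of \<open>g\<close> by some
  \<open>c\<close> in \<open>D\<close>, and \<open>c\<close> commutes with
  \<open>g [^] p\<close>.\<close>

lemma coset_pow:
  assumes g: "g \<in> carrier G" "g \<notin> ZD" "g [^] int p \<in> ZD" and d: "d \<in> D"
  shows "(d \<otimes> g) [^] int p = g [^] int p"
proof -
  obtain c where c: "c \<in> D" "d \<otimes> g = c \<otimes> g \<otimes> inv c"
    using coset_conjugate[OF g(1,2) d] .
  have cc: "c \<in> carrier G"
    using c D_closed by blast
  have "(d \<otimes> g) [^] int p = c \<otimes> g [^] int p \<otimes> inv c"
    using c cc g by (simp add: int_pow_conjugate)
  also have "c \<otimes> g [^] int p = g [^] int p \<otimes> c"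
    using g(3) c(1) by simp
  finally show ?thesis
    using cc g(1) by (simp add: m_assoc)
qed

end

section \<open>Inversion of the chain and the generalised quaternion section\<close>

context divisible_chain
begin

text \<open>For odd \<open>p\<close>, \<open>g\<close> would act on an element \<open>y\<close> of order \<open>p\<^sup>2\<close> by \<open>y \<mapsto> c \<otimes> y\<close> with \<open>c\<close> central of
  order dividing \<open>p\<close>, so the factor \<open>c\<close> would disappear from \<open>(y \<otimes> g) [^] p\<close>, leaving
  \<open>y [^] p \<otimes> g [^] p \<noteq> g [^] p\<close>.\<close>

lemma p_eq_2:
  assumes g: "g \<in> carrier G" "g \<notin> ZD" "g [^] int p \<in> ZD"
  shows "p = 2"
proof (rule ccontr)
  assume "p \<noteq> 2"
  then have odd: "p > 2"
    using prime_ge_2_nat[OF prime] by simp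
  \<comment> \<open>A central element of order \<open>p\<close> in \<open>D\<close>; the element
    \<open>y\<close> below, a \<open>p\<close>-th root of it, has order
    \<open>p ^ 2\<close>.\<close>
  define k1 where "k1 = k [^] int (p ^ (n - 1))"
  have pn: "p ^ (n - 1) * p = p ^ n"
    using n_pos by (cases n) auto
  have "k1 [^] int p = k [^] int (p ^ n)"
    unfolding k1_def pn[symmetric] using k_closed by (simp add: int_pow_pow)
  also have "\<dots> = \<one>"
    by (simp only: int_pow_eq_id[OF k_closed] ord_k dvd_refl)
  finally have k1: "k1 \<in> D" "k1 [^] int p = \<one>"
    unfolding k1_def using subgroup_int_pow_closed[OF D_sub k_in_D] by auto
  have "\<not> p ^ n dvd p ^ (n - 1)"
    using n_pos prime_gt_1_nat[OF prime] by (simp add: power_dvd_imp_le nat_dvd_not_less)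
  then have k1_ne: "k1 \<noteq> \<one>"
    unfolding k1_def int_pow_eq_id[OF k_closed] ord_k int_dvd_int_iff .
  have k1_central: "k1 \<otimes> x = x \<otimes> k1" if "x \<in> carrier G" for x
    using int_pow_commute[OF k_central[OF that] k_closed that, of _ 1] that by (simp add: k1_def)
  have k1c: "k1 \<in> carrier G"
    using k1 D_closed by blast
  obtain y where y: "y \<in> D" "k1 = y [^] int p"
    using D_divisible[OF k1(1)] prime_gt_0_nat[OF prime] by blast
  have yc: "y \<in> carrier G"
    using y D_closed by blast
  define c where "c = g \<otimes> y \<otimes> inv g \<otimes> inv y"
  have c: "c \<in> D"
    unfolding c_def using conj_in_D[OF g(1) y(1)] D_sub y(1) by (simp add: subgroup.m_closed subgroup.m_inv_closed)
  have cc: "c \<in> carrier G"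
    using c D_closed by blast
  have gy: "g \<otimes> y \<otimes> inv g = c \<otimes> y"
    unfolding c_def using g(1) yc by (simp add: m_assoc inv_cancel_left)
  have gyi: "g \<otimes> y [^] i = c [^] i \<otimes> y [^] i \<otimes> g" for i :: int
  proof -
    have "g \<otimes> y [^] i \<otimes> inv g = c [^] i \<otimes> y [^] i"
      using int_pow_conjugate[OF g(1) yc, of i] int_pow_mult_distrib[OF D_commute[OF c y(1)] cc yc, of i]
      by (simp add: gy)
    then have "g \<otimes> y [^] i \<otimes> inv g \<otimes> g = c [^] i \<otimes> y [^] i \<otimes> g"
      by simp
    then show ?thesis
      using g(1) yc by (simp add: m_assoc)
  qed
  \<comment> \<open>\<open>y [^] p\<close> is the central \<open>k1\<close>, which conjugation by
    \<open>g\<close> leaves unchanged.\<close>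
  have "c [^] int p \<otimes> k1 = k1"
    using gyi[of "int p"] k1_central[OF g(1)] y(2) cc g(1) k1c by (metis int_pow_closed m_closed right_cancel)
  then have cp: "c [^] int p = \<one>"
    using cc k1c by simp
  \<comment> \<open>Elements of \<open>D\<close> killed by \<open>p\<close> lie in its subgroup of
    order \<open>p\<close>; this makes \<open>c\<close> central.\<close>
  have "c \<in> generate G {k1}"
    using D_chain[OF c k1(1)]
  proof
    assume "k1 \<in> generate G {c}"
    then obtain i :: int where i: "k1 = c [^] i"
      using generate_singleton_iff[OF cc] by blast
    have "\<not> int p dvd i"
    proof
      assume "int p dvd i"
      then obtain j where "i = int p * j"
        by (elim dvdE)
      then have "k1 = (c [^] int p) [^] j"
        using i cc by (simp add: int_pow_pow)
      then show False
        using cp k1_ne by simp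
    qed
    then have "coprime (int p) i"
      using prime by (simp add: prime_imp_coprime)
    then show ?thesis
      unfolding i by (rule generate_int_pow_coprime[OF cc cp])
  qed
  then have c_central: "c [^] i \<otimes> x = x \<otimes> c [^] i" if "x \<in> carrier G" for x and i :: int
    using int_pow_commute[of c x i 1] generate_singleton_commute[OF _ k1c k1_central[OF that] that] that cc
    by simp
  \<comment> \<open>Moving the factors \<open>g\<close> past powers of \<open>y\<close> costs powers
    of \<open>c\<close> with exponents 0, 1, ..., i - 1, which add up to
    \<open>i choose 2\<close>.\<close>
  have main: "(y \<otimes> g) [^] int i = c [^] int (i choose 2) \<otimes> (y [^] int i \<otimes> g [^] int i)" for i
  proof (induction i)
    case (Suc i)
    have step: "x [^] int (Suc i) = x \<otimes> x [^] int i" if "x \<in> carrier G" for x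
      using int_pow_mult[OF that, of 1 "int i"] that by simp
    have "(y \<otimes> g) [^] int (Suc i) = y \<otimes> g \<otimes> (c [^] int (i choose 2) \<otimes> (y [^] int i \<otimes> g [^] int i))"
      using step[of "y \<otimes> g"] yc g(1) Suc by simp
    also have "\<dots> = y \<otimes> g \<otimes> c [^] int (i choose 2) \<otimes> (y [^] int i \<otimes> g [^] int i)"
      using yc g(1) cc by (simp add: m_assoc)
    also have "y \<otimes> g \<otimes> c [^] int (i choose 2) = c [^] int (i choose 2) \<otimes> (y \<otimes> g)"
      using c_central[of "y \<otimes> g"] yc g(1) by simp
    also have "c [^] int (i choose 2) \<otimes> (y \<otimes> g) \<otimes> (y [^] int i \<otimes> g [^] int i) =
        c [^] int (i choose 2) \<otimes> (y \<otimes> (g \<otimes> y [^] int i) \<otimes> g [^] int i)"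
      using yc g(1) cc by (simp add: m_assoc)
    also have "\<dots> = c [^] int (i choose 2) \<otimes> (y \<otimes> c [^] int i \<otimes> (y [^] int i \<otimes> g \<otimes> g [^] int i))"
      unfolding gyi using yc g(1) cc by (simp add: m_assoc)
    also have "y \<otimes> c [^] int i = c [^] int i \<otimes> y"
      using c_central[OF yc] by simp
    also have "c [^] int (i choose 2) \<otimes> (c [^] int i \<otimes> y \<otimes> (y [^] int i \<otimes> g \<otimes> g [^] int i)) =
        c [^] int (i choose 2) \<otimes> c [^] int i \<otimes> ((y \<otimes> y [^] int i) \<otimes> (g \<otimes> g [^] int i))"
      using yc g(1) cc by (simp add: m_assoc)
    also have "c [^] int (i choose 2) \<otimes> c [^] int i = c [^] int (Suc i choose 2)"
      using cc by (simp add: int_pow_mult[symmetric] numeral_2_eq_2 add.commute)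
    finally show ?case
      using step[OF yc] step[OF g(1)] by simp
  qed (simp add: numeral_2_eq_2)
  \<comment> \<open>This is where \<open>p > 2\<close> enters: for \<open>p = 2\<close> the binomial
    coefficient is 1.\<close>
  have "p dvd p choose 2"
    using odd prime by (intro dvd_choose_prime) auto
  then have "c [^] int (p choose 2) = \<one>"
    using cp cc int_pow_eq_id[OF cc] by (meson dvd_trans int_dvd_int_iff)
  then have "(y \<otimes> g) [^] int p = k1 \<otimes> g [^] int p"
    using main[of p] yc g(1) y(2) by simp
  then have "k1 = \<one>"
    using coset_pow[OF g y(1)] k1c g(1) by simp
  then show False
    using k1_ne by simp
qed


text \<open>For \<open>p = 2\<close>, the equation \<open>(d \<otimes> g) [^] 2 = g [^] 2\<close>
  says that \<open>g\<close> inverts \<open>d\<close>. The central \<open>k\<close> is thus its own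
  inverse, so it is the involution among the powers of \<open>g\<close>.\<close>

lemma obtain_inverting:
  obtains g m where "g \<in> carrier G" "g \<notin> ZD" "\<forall>d\<in>D. g \<otimes> d \<otimes> inv g = inv d"
    "k [^] (2::int) = \<one>" "k = g [^] (2 * 2 ^ m :: int)" "p = 2"
proof -
  obtain g t where g: "g \<in> carrier G" "g \<notin> ZD" "ord g = p ^ t" "g [^] int p \<in> ZD"
    using obtain_minimal_noncentralizing .
  have p: "p = 2"
    using p_eq_2 g by blast
  have inverts: "g \<otimes> d \<otimes> inv g = inv d" if d: "d \<in> D" for d
  proof -
    have dc: "d \<in> carrier G"
      using d D_closed by blast
    have sq: "x [^] (2::int) = x \<otimes> x" if "x \<in> carrier G" for x
      using int_pow_mult[OF that, of 1 1] that by simp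
    have "d \<otimes> g \<otimes> (d \<otimes> g) = g \<otimes> g"
      using coset_pow[OF g(1,2,4) d] dc g(1) sq[of g] sq[of "d \<otimes> g"] by (simp add: p)
    then have "d \<otimes> (g \<otimes> d) \<otimes> g = g \<otimes> g"
      using dc g(1) by (simp add: m_assoc)
    then have "d \<otimes> (g \<otimes> d) = g"
      using dc g(1) right_cancel[of g "d \<otimes> (g \<otimes> d)" g] by simp
    then have "inv d \<otimes> (d \<otimes> (g \<otimes> d)) \<otimes> inv g = inv d \<otimes> g \<otimes> inv g"
      by simp
    then show ?thesis
      using dc g(1) by (simp add: inv_cancel_left m_assoc)
  qed
  have "g \<otimes> k = k \<otimes> g"
    using k_central[OF g(1)] by simp
  then have "inv k = k"
    using inverts[OF k_in_D] g(1) k_closed by (simp add: m_assoc)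
  then have k2: "k [^] (2::int) = \<one>"
    using int_pow_mult[OF k_closed, of 1 1] k_closed by (metis int_pow_1 one_add_one r_inv)
  obtain i :: int where i: "k = g [^] i"
    using k_in_generate[OF g(1,2)] generate_singleton_iff[OF g(1)] by blast
  have og: "int (ord g) = 2 ^ t"
    using g(3) p by simp
  have "g [^] (i * 2) = \<one>"
    using k2 i g(1) by (simp add: int_pow_pow)
  then have d2: "2 ^ t dvd i * 2"
    using int_pow_eq_id[OF g(1)] og by simp
  have nd: "\<not> 2 ^ t dvd i"
    using k_ne_one int_pow_eq_id[OF g(1)] og i by simp
  then obtain s where s: "t = Suc s"
    by (cases t) auto
  then have "2 ^ s dvd i"
    using d2 by simp
  then obtain j where j: "i = 2 ^ s * j"
    by (elim dvdE)
  have "odd j"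
    using nd j s by auto
  then obtain l where l: "j = 2 * l + 1"
    by (elim oddE)
  \<comment> \<open>An odd multiple of half the order of \<open>g\<close> may be replaced by half
    the order itself.\<close>
  have "int (ord g) dvd 2 ^ s - i"
    unfolding og s j l by (simp add: algebra_simps)
  then have ks: "k = g [^] (2 ^ s :: int)"
    using i int_pow_eq[OF g(1)] by simp
  \<comment> \<open>For \<open>s = 0\<close>, \<open>g\<close> would be the central
    \<open>k\<close>. A positive \<open>s\<close> makes \<open>k\<close> a power of the square of
    \<open>g\<close>.\<close>
  have "s \<noteq> 0"
  proof
    assume "s = 0"
    then have "k = g"
      using ks g(1) by simp
    then show False
      using g(2) k_central D_closed k_closed by auto
  qed
  then obtain m where "s = Suc m"
    by (cases s) auto
  then have "k = g [^] (2 * 2 ^ m :: int)"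
    using ks by simp
  then show ?thesis
    using that g inverts k2 p by blast
qed

text \<open>The section is the infinite generalised quaternion group: \<open>B = D\<langle>u\<rangle>\<close> is abelian of index 2 in
  \<open>L = D\<langle>g\<rangle>\<close>, and \<open>N\<close> is the kernel of \<open>x \<mapsto> x [^] (2 ^ m)\<close> on \<open>B\<close>, a map onto \<open>D\<close> that sends \<open>u\<close> to the
  involution \<open>k\<close>.\<close>

lemma tight_section_exists:
  "\<exists>L N a. subgroup L G \<and> finite (rcosets L) \<and> tight_section p (G\<lparr>carrier := L\<rparr>) N a"
proof -
  obtain g m where g: "g \<in> carrier G" "g \<notin> ZD" and inverts': "\<forall>d\<in>D. g \<otimes> d \<otimes> inv g = inv d"
    and k2: "k [^] (2::int) = \<one>" and kg: "k = g [^] (2 * 2 ^ m :: int)" and p: "p = 2"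
    using obtain_inverting .
  have inverts: "g \<otimes> d \<otimes> inv g = inv d" if "d \<in> D" for d
    using inverts' that by blast
  \<comment> \<open>The square of an element inverting \<open>D\<close> centralises
    \<open>D\<close>, and \<open>k\<close> is a power of it.\<close>
  define u where "u = g [^] (2::int)"
  have u: "u \<in> carrier G"
    using g by (simp add: u_def)
  have gd: "g \<otimes> d = inv d \<otimes> g" if "d \<in> D" for d
  proof -
    have "g \<otimes> d = g \<otimes> d \<otimes> inv g \<otimes> g"
      using g(1) D_closed[OF that] by (simp add: m_assoc)
    then show ?thesis
      using inverts[OF that] by simp
  qed
  have sq: "x [^] (2::int) = x \<otimes> x" if "x \<in> carrier G" for x
    using int_pow_mult[OF that, of 1 1] that by simp
  have u_D: "u \<otimes> d = d \<otimes> u" if d: "d \<in> D" for d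
  proof -
    have "u \<otimes> d = g \<otimes> (g \<otimes> d)"
      using g(1) D_closed[OF d] by (simp add: u_def sq m_assoc)
    also have "\<dots> = g \<otimes> inv d \<otimes> g"
      using gd[OF d] g(1) D_closed[OF d] by (simp add: m_assoc)
    also have "\<dots> = d \<otimes> g \<otimes> g"
      using gd[of "inv d"] d D_sub D_closed[OF d] by (simp add: subgroup.m_inv_closed)
    finally show ?thesis
      using g(1) D_closed[OF d] by (simp add: u_def sq m_assoc)
  qed
  have ui_D: "u [^] i \<otimes> d = d \<otimes> u [^] i" if "d \<in> D" for d and i :: int
    using int_pow_commute[OF u_D[OF that] u D_closed[OF that], of i 1] D_closed[OF that] by simp
  have u_g: "u [^] i \<otimes> g [^] j = g [^] j \<otimes> u [^] i" for i j :: int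
    using g(1) by (simp add: u_def int_pow_pow int_pow_mult[symmetric] add.commute)
  have u_g1: "u [^] i \<otimes> g = g \<otimes> u [^] i" for i :: int
    using u_g[of i 1] g(1) by simp
  define B where "B = {d \<otimes> u [^] i | d i. d \<in> D \<and> (i::int) \<in> UNIV}"
  define L where "L = {d \<otimes> g [^] i | d i. d \<in> D \<and> (i::int) \<in> UNIV}"
  have setmult: "{d \<otimes> x [^] i | d i. d \<in> D \<and> (i::int) \<in> UNIV} = D <#> generate G {x}"
    if "x \<in> carrier G" for x
    unfolding set_mult_def generate_pow[OF that] by blast
  have B_sub: "subgroup B G" and L_sub: "subgroup L G"
    unfolding B_def L_def setmult[OF u] setmult[OF g(1)]
    using mult_norm_subgroup[OF D_normal] subgroup_generate_singleton u g(1) by auto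
  have D_B: "D \<subseteq> B" and D_L: "D \<subseteq> L"
    unfolding B_def L_def using D_closed by (force intro!: exI[of _ "0::int"])+
  have B_L: "B \<subseteq> L"
  proof
    fix x assume "x \<in> B"
    then obtain d and i :: int where "d \<in> D" "x = d \<otimes> g [^] (2 * i)"
      using g(1) by (auto simp: B_def u_def int_pow_pow)
    then show "x \<in> L"
      by (auto simp: L_def)
  qed
  have u_B: "u [^] i \<in> B" for i :: int
    unfolding B_def using u subgroup.one_closed[OF D_sub] by (force intro!: exI[of _ \<one>])
  have uB1: "u \<in> B"
    using u_B[of 1] u by simp
  have B_closed: "x \<in> carrier G" if "x \<in> B" for x
    using that B_sub subgroup.subset by blast
  have L_closed: "x \<in> carrier G" if "x \<in> L" for x
    using that L_sub subgroup.subset by blast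
  have B_ZD: "x \<in> ZD" if x: "x \<in> B" for x
  proof -
    obtain d i where di: "d \<in> D" "x = d \<otimes> u [^] (i::int)"
      using x by (auto simp: B_def)
    have "x \<otimes> e = e \<otimes> x" if e: "e \<in> D" for e
    proof -
      have "x \<otimes> e = d \<otimes> (u [^] i \<otimes> e)"
        using di D_closed e u by (simp add: m_assoc)
      also have "\<dots> = d \<otimes> e \<otimes> u [^] i"
        using ui_D[OF e] di D_closed e u by (simp add: m_assoc)
      also have "\<dots> = e \<otimes> x"
        using D_commute[OF di(1) e] di D_closed e u by (simp add: m_assoc)
      finally show ?thesis .
    qed
    then show ?thesis
      using B_closed[OF x] by blast
  qed
  have B_u: "x \<otimes> u [^] j = u [^] j \<otimes> x" if x: "x \<in> B" for x and j :: int
  proof -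
    obtain d i where di: "d \<in> D" "x = d \<otimes> u [^] (i::int)"
      using x by (auto simp: B_def)
    have "x \<otimes> u [^] j = d \<otimes> u [^] j \<otimes> u [^] i"
      using di D_closed u by (simp add: m_assoc int_pow_mult[symmetric] add.commute)
    also have "d \<otimes> u [^] j = u [^] j \<otimes> d"
      using ui_D[OF di(1)] by simp
    finally show ?thesis
      using di D_closed u by (simp add: m_assoc)
  qed
  have B_commute: "x \<otimes> y = y \<otimes> x" if x: "x \<in> B" and y: "y \<in> B" for x y
  proof -
    obtain d i where di: "d \<in> D" "y = d \<otimes> u [^] (i::int)"
      using y by (auto simp: B_def)
    have "x \<otimes> y = x \<otimes> d \<otimes> u [^] i"
      using di D_closed u B_closed[OF x] by (simp add: m_assoc)
    also have "\<dots> = d \<otimes> (x \<otimes> u [^] i)"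
      using B_ZD[OF x] di(1) D_closed u B_closed[OF x] by (simp add: m_assoc)
    finally show ?thesis
      using B_u[OF x] di D_closed u B_closed[OF x] by (simp add: m_assoc)
  qed
  have B_conj: "x \<otimes> h \<otimes> inv x \<in> B" if x: "x \<in> L" and h: "h \<in> B" for x h
  proof -
    obtain d i where di: "d \<in> D" "x = d \<otimes> g [^] (i::int)"
      using x by (auto simp: L_def)
    obtain e j where ej: "e \<in> D" "h = e \<otimes> u [^] (j::int)"
      using h by (auto simp: B_def)
    have cl: "d \<in> carrier G" "e \<in> carrier G"
      using di ej D_closed by auto
    have "x \<otimes> h \<otimes> inv x = x \<otimes> e \<otimes> (u [^] j \<otimes> inv x)"
      using ej cl u L_closed[OF x] by (simp add: m_assoc)
    also have "u [^] j \<otimes> inv x = inv x \<otimes> u [^] j"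
    proof -
      have "u [^] j \<otimes> x = x \<otimes> u [^] j"
        using di cl u g(1) u_g[of j i] ui_D[OF di(1), of j] by (metis m_assoc int_pow_closed)
      then show ?thesis
        using int_pow_commute[of "u [^] j" x 1 "-1"] u L_closed[OF x] by (simp add: int_pow_neg)
    qed
    also have "x \<otimes> e \<otimes> (inv x \<otimes> u [^] j) = (x \<otimes> e \<otimes> inv x) \<otimes> u [^] j"
      using cl u L_closed[OF x] by (simp add: m_assoc)
    finally show ?thesis
      using conj_in_D[OF L_closed[OF x] ej(1)] unfolding B_def by blast
  qed
  \<comment> \<open>Chosen so that \<open>u [^] q = k\<close>: then \<open>u\<close> is outside the
    kernel \<open>N\<close>, while its square is inside.\<close>
  define q where "q = (2 ^ m :: int)"
  have uq: "u [^] (i * q) = k [^] i" for i :: int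
    using g(1) unfolding kg u_def q_def by (simp add: int_pow_pow mult.commute mult.left_commute)
  define N where "N = {x \<in> B. x [^] q = \<one>}"
  have N_sub: "subgroup N G"
  proof (rule subgroupI)
    show "N \<noteq> {}"
      using subgroup.one_closed[OF B_sub] by (auto simp: N_def)
  next
    fix x assume "x \<in> N"
    then show "inv x \<in> N"
      using B_closed subgroup.m_inv_closed[OF B_sub] by (auto simp: N_def int_pow_inv)
  next
    fix x y assume "x \<in> N" "y \<in> N"
    then show "x \<otimes> y \<in> N"
      using B_closed B_commute subgroup.m_closed[OF B_sub] by (auto simp: N_def int_pow_mult_distrib)
  qed (auto simp: N_def B_closed)
  have N_L: "N \<subseteq> L"
    using B_L by (auto simp: N_def)
  have N_fin: "finite N"
    by (rule finite_subset[OF _ finite_ZD_torsion[of "2 ^ m"]]) (use B_ZD in \<open>auto simp: N_def q_def\<close>)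
  let ?L = "G\<lparr>carrier := L\<rparr>"
  have L_group: "group ?L"
    using L_sub subgroup_imp_group by blast
  have N_normal: "N \<lhd> ?L"
  proof (rule group.normal_invI[OF L_group])
    show "subgroup N ?L"
      by (rule subgroup_incl[OF N_sub L_sub N_L])
    fix x h assume x: "x \<in> carrier ?L" and h: "h \<in> N"
    have "(x \<otimes> h \<otimes> inv x) [^] q = \<one>"
      using x h L_closed B_closed by (simp add: int_pow_conjugate N_def)
    then have "x \<otimes> h \<otimes> inv x \<in> N"
      using x h B_conj by (simp add: N_def)
    then show "x \<otimes>\<^bsub>?L\<^esub> h \<otimes>\<^bsub>?L\<^esub> inv\<^bsub>?L\<^esub> x \<in> N"
      using x L_sub by simp
  qed
  have socle: "\<exists>i::int. x [^] i \<otimes> inv u \<in> N" if x: "x \<in> L" "x \<notin> N" for x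
  proof -
    obtain d i where di: "d \<in> D" "x = d \<otimes> g [^] (i::int)"
      using x by (auto simp: L_def)
    have dc: "d \<in> carrier G"
      using di D_closed by blast
    show ?thesis
    proof (cases "even i")
      case True
      then obtain j where "i = 2 * j"
        by (elim evenE)
      then have xj: "x = d \<otimes> u [^] j"
        using di g(1) by (simp add: u_def int_pow_pow)
      then have xB: "x \<in> B"
        using di by (auto simp: B_def)
      \<comment> \<open>\<open>y\<close> is a nontrivial element of \<open>D\<close>, and
        \<open>k\<close> is the only involution of \<open>D\<close>, so \<open>k\<close> is a power
        of \<open>y\<close>.\<close>
      define y where "y = x [^] q"
      have "y = d [^] q \<otimes> k [^] j"
        unfolding y_def xj using ui_D[OF di(1), of j] dc u by (simp add: int_pow_mult_distrib int_pow_pow uq)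
      then have yD: "y \<in> D"
        using di(1) k_in_D D_sub subgroup_int_pow_closed subgroup.m_closed by metis
      have yc: "y \<in> carrier G"
        using yD D_closed by blast
      have y1: "y \<noteq> \<one>"
        using x xB by (simp add: N_def y_def)
      have "k \<in> generate G {y}"
        using D_chain[OF k_in_D yD]
      proof
        assume "y \<in> generate G {k}"
        then obtain l :: int where l: "y = k [^] l"
          using generate_singleton_iff[OF k_closed] by blast
        have "odd l"
        proof
          assume "even l"
          then have "y = \<one>"
            using l k2 k_closed by (metis evenE int_pow_one int_pow_pow)
          then show False
            using y1 by simp
        qed
        then obtain s where "l = 2 * s + 1"
          by (elim oddE)
        then have "y = (k [^] (2::int)) [^] s \<otimes> k"
          using l k_closed by (simp add: int_pow_mult int_pow_pow)
        then have "y = k"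
          using k2 k_closed by simp
        then show ?thesis
          using k_closed generate_singleton_self by simp
      qed
      then obtain l :: int where l: "k = y [^] l"
        using generate_singleton_iff[OF yc] by blast
      have xl: "x [^] l \<in> B" "inv u \<in> B"
        using xB uB1 B_sub by (auto simp: subgroup_int_pow_closed subgroup.m_inv_closed)
      have "(x [^] l \<otimes> inv u) [^] q = x [^] (l * q) \<otimes> inv (u [^] q)"
        using int_pow_mult_distrib[OF B_commute[OF xl] B_closed[OF xl(1)] B_closed[OF xl(2)], of q]
          B_closed[OF xB] u by (simp add: int_pow_pow int_pow_inv)
      also have "x [^] (l * q) = k"
        using l B_closed[OF xB] by (simp add: y_def int_pow_pow mult.commute)
      also have "u [^] q = k"
        using uq[of 1] k_closed by simp
      finally have "x [^] l \<otimes> inv u \<in> N"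
        using xl k_closed by (simp add: N_def subgroup.m_closed[OF B_sub])
      then show ?thesis
        by blast
    next
      case False
      then obtain j where "i = 1 + 2 * j"
        by (metis oddE add.commute)
      then have xj: "x = d \<otimes> (g \<otimes> u [^] j)"
        using di g(1) by (simp add: u_def int_pow_pow int_pow_mult)
      \<comment> \<open>Inversion cancels \<open>d\<close>, so \<open>x\<close> squares to an odd
        power of \<open>u\<close>, which is \<open>u\<close> modulo \<open>N\<close>.\<close>
      have "x [^] (2::int) = d \<otimes> (g \<otimes> u [^] j) \<otimes> (d \<otimes> (g \<otimes> u [^] j))"
        using sq[OF L_closed[OF x(1)]] xj by simp
      also have "\<dots> = d \<otimes> (g \<otimes> (u [^] j \<otimes> d) \<otimes> g) \<otimes> u [^] j"
        using dc g(1) u by (simp add: m_assoc)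
      also have "g \<otimes> (u [^] j \<otimes> d) = inv d \<otimes> g \<otimes> u [^] j"
        using ui_D[OF di(1), of j] gd[OF di(1)] dc g(1) u by (simp add: m_assoc[symmetric])
      also have "d \<otimes> (inv d \<otimes> g \<otimes> u [^] j \<otimes> g) \<otimes> u [^] j = g \<otimes> (u [^] j \<otimes> g) \<otimes> u [^] j"
        using dc g(1) u by (simp add: m_assoc inv_cancel_left)
      also have "\<dots> = u \<otimes> u [^] (2 * j)"
        using u_g1[of j] g(1) u by (simp add: m_assoc u_def sq int_pow_mult[symmetric])
      finally have "x [^] (2::int) = u [^] (2 * j) \<otimes> u"
        using int_pow_mult[OF u, of 1 "2 * j"] int_pow_mult[OF u, of "2 * j" 1] u by (simp add: add.commute)
      then have "x [^] (2::int) \<otimes> inv u = u [^] (2 * j)"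
        using u by (simp add: m_assoc)
      moreover have "u [^] (2 * j) \<in> N"
      proof -
        have "(u [^] (2 * j)) [^] q = (k [^] (2::int)) [^] j"
          using u k_closed uq[of "2 * j"] by (simp add: int_pow_pow)
        then show ?thesis
          using u_B k2 by (simp add: N_def)
      qed
      ultimately show ?thesis
        by (metis (no_types))
    qed
  qed
  have u_N: "u \<notin> N"
    using uq[of 1] k_ne_one k_closed by (simp add: N_def)
  have u2_N: "u [^] int p \<in> N"
  proof -
    have "(u [^] (2::int)) [^] q = k [^] (2::int)"
      using u uq[of 2] by (simp add: int_pow_pow)
    then show ?thesis
      using u_B k2 p by (simp add: N_def)
  qed
  have tight: "\<exists>i::int. u [^] i \<otimes> inv x \<in> N"
    if x: "x \<in> L" and fin: "finite {h \<in> L. \<forall>i::int. h [^] i \<otimes> inv x \<notin> N}" for x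
  proof -
    let ?E = "{h \<in> L. \<forall>i::int. h [^] i \<otimes> inv x \<notin> N}"
    have xc: "x \<in> carrier G"
      using x L_closed by blast
    \<comment> \<open>Finiteness is tested on two infinite sets: \<open>D\<close> forces
      \<open>x\<close> into \<open>B\<close>, then the coset of \<open>g\<close> forces
      \<open>x\<close> to be a power of \<open>u\<close> modulo \<open>N\<close>.\<close>
    have "\<not> D \<subseteq> ?E"
      using fin D_infinite finite_subset by blast
    then obtain d and i :: int where d: "d \<in> D" "d [^] i \<otimes> inv x \<in> N"
      using D_L by blast
    have xB: "x \<in> B"
    proof -
      have "inv (d [^] i \<otimes> inv x) \<otimes> d [^] i \<in> B"
        using d D_B B_sub by (auto simp: N_def subgroup.m_closed subgroup.m_inv_closed subgroup_int_pow_closed)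
      also have "inv (d [^] i \<otimes> inv x) \<otimes> d [^] i = x"
        using xc D_closed[OF d(1)] by (simp add: inv_mult_group m_assoc)
      finally show ?thesis .
    qed
    have "inj_on (\<lambda>d. d \<otimes> g) D"
      using inj_on_multc[OF g(1)] inj_on_subset subgroup.subset[OF D_sub] by blast
    then have "infinite ((\<lambda>d. d \<otimes> g) ` D)"
      using D_infinite finite_imageD by blast
    then have "\<not> (\<lambda>d. d \<otimes> g) ` D \<subseteq> ?E"
      using fin finite_subset by blast
    moreover have "d \<otimes> g \<in> L" if "d \<in> D" for d
      unfolding L_def using that g(1) by (force intro!: exI[of _ "1::int"])
    ultimately obtain d and i :: int where d: "d \<in> D" "(d \<otimes> g) [^] i \<otimes> inv x \<in> N"
      by blast
    have dc: "d \<in> carrier G"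
      using d D_closed by blast
    have "(d \<otimes> g) [^] (2::int) = d \<otimes> (g \<otimes> d) \<otimes> g"
      using sq[of "d \<otimes> g"] dc g(1) by (simp add: m_assoc)
    also have "\<dots> = u"
      using gd[OF d(1)] dc g(1) by (simp add: m_assoc inv_cancel_left u_def sq)
    finally have dg2: "(d \<otimes> g) [^] (2 * j) = u [^] j" for j :: int
      using dc g(1) by (simp add: int_pow_pow[symmetric])
    show ?thesis
    proof (cases "even i")
      case True
      then obtain j where "i = 2 * j"
        by (elim evenE)
      then show ?thesis
        using d(2) dg2 by auto
    next
      case False
      then obtain j where "i = 2 * j + 1"
        by (elim oddE)
      then have "(d \<otimes> g) [^] i = u [^] j \<otimes> (d \<otimes> g)"
        using int_pow_mult[of "d \<otimes> g" "2 * j" 1] dg2 dc g(1) by simp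
      \<comment> \<open>An odd exponent would put \<open>g\<close> into \<open>B\<close>, which
        centralises \<open>D\<close>.\<close>
      then have "u [^] j \<otimes> (d \<otimes> g) \<otimes> inv x \<in> B"
        using d(2) by (simp add: N_def)
      then have "inv d \<otimes> (inv (u [^] j) \<otimes> (u [^] j \<otimes> (d \<otimes> g) \<otimes> inv x \<otimes> x)) \<in> B"
        using xB u_B d(1) D_B B_sub by (auto simp: subgroup.m_closed subgroup.m_inv_closed)
      also have "inv d \<otimes> (inv (u [^] j) \<otimes> (u [^] j \<otimes> (d \<otimes> g) \<otimes> inv x \<otimes> x)) = g"
        using xc dc g(1) u by (simp add: m_assoc inv_cancel_left)
      finally show ?thesis
        using B_ZD g(2) by blast
    qed
  qed
  have u_L: "u \<in> L"
    using uB1 B_L by blast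
  have "tight_section p ?L N u"
    unfolding tight_section_def socle_section_def
    using N_normal N_fin u_L u_N u2_N socle tight
    by (simp add: int_pow_consistent[OF L_sub, symmetric] L_sub cong: conj_cong)
  then show ?thesis
    using L_sub finite_rcosets_mono[OF D_sub L_sub D_L D_index] by blast
qed

end

section \<open>The section of a group with cyclic \<open>K(G)\<close>\<close>

context group
begin

lemma subgroup_center: "subgroup (center G) G"
  using subgroup_commuting[of "carrier G"] by (simp add: center_def)

lemma central_subgroup_normal:
  assumes N: "subgroup N G" and sub: "N \<subseteq> center G"
  shows "N \<lhd> G"
proof (rule normal_invI[OF N])
  fix x h assume x: "x \<in> carrier G" and h: "h \<in> N"
  have "x \<otimes> h = h \<otimes> x"
    using center_commute[of h G x] sub h x by auto
  then show "x \<otimes> h \<otimes> inv x \<in> N"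
    using h x subgroup.subset[OF N] by (simp add: m_assoc subset_iff)
qed

text \<open>Makes \<open>eta k G\<close> a normal subset, so its centraliser is normal and, when the
  set is finite, of finite index.\<close>

lemma eta_conjugate:
  assumes k: "k \<in> center G" and x: "x \<in> carrier G" and f: "f \<in> eta k G"
  shows "x \<otimes> f \<otimes> inv x \<in> eta k G"
  using central_in_generate_conjugate[OF center_closed[OF k] center_commute[OF k x] x] f x
  by (auto simp: eta_def)

text \<open>A subgroup omitting \<open>k\<close> lies in the finite set \<open>eta k G\<close>, so a maximal such subgroup of the
  centre exists and is finite.\<close>

lemma central_eta_socle_section:
  assumes p: "prime p" and n: "n \<ge> 1" and ord_k: "ord k = p ^ n"
    and k: "k \<in> center G" and fin: "finite (eta k G)" and central: "eta k G \<subseteq> center G"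
  obtains N where "N \<subseteq> center G" "socle_section p G N k"
proof -
  define S where "S = {N. subgroup N G \<and> N \<subseteq> center G \<and> k [^] int p \<in> N \<and> k \<notin> N}"
  have kc: "k \<in> carrier G"
    by (rule center_closed[OF k])
  have sub_eta: "N \<subseteq> eta k G" if "N \<in> S" for N
  proof
    fix x assume x: "x \<in> N"
    have N: "subgroup N G" "k \<notin> N"
      using that by (auto simp: S_def)
    then show "x \<in> eta k G"
      using x generate_singleton_in_subgroup[OF N(1) x] subgroup.subset[OF N(1)] by (auto simp: eta_def)
  qed
  then have "finite S"
    using fin by (meson PowI finite_Pow_iff finite_subset subsetI)
  moreover have "generate G {k [^] int p} \<in> S"
  proof -
    have "k \<notin> generate G {k [^] int p}"
    proof
      assume "k \<in> generate G {k [^] int p}"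
      then obtain i where "k = k [^] (int p * i)"
        using kc generate_singleton_iff[of "k [^] int p"] by (auto simp: int_pow_pow)
      then have "int (p ^ n) dvd int p * i - 1"
        using kc int_pow_eq[of k 1 "int p * i"] ord_k by simp
      moreover have "int p dvd int (p ^ n)"
        using n by simp
      ultimately have "int p dvd int p * i - 1"
        by (rule dvd_trans[rotated])
      then have "int p dvd 1"
        by (metis dvd_diff_right_iff dvd_triv_left)
      then show False
        using p by simp
    qed
    moreover have "k [^] int p \<in> center G"
      using subgroup_int_pow_closed[OF subgroup_center k] .
    ultimately show ?thesis
      unfolding S_def using kc generate_subset_center subgroup_generate_singleton generate_singleton_self by auto
  qed
  ultimately obtain N where NS: "N \<in> S" and maximal: "\<And>M. M \<in> S \<Longrightarrow> N \<subseteq> M \<Longrightarrow> N = M"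
    using finite_has_maximal[of S] by blast
  have N: "subgroup N G" "N \<subseteq> center G" "k [^] int p \<in> N" "k \<notin> N"
    using NS by (auto simp: S_def)
  have normal: "N \<lhd> G"
    by (rule central_subgroup_normal[OF N(1,2)])
  have "\<exists>i::int. x [^] i \<otimes> inv k \<in> N" if x: "x \<in> carrier G - N" for x
  proof (cases "k \<in> generate G {x}")
    case True
    then obtain i :: int where "k = x [^] i"
      using x generate_singleton_iff by blast
    then show ?thesis
      using kc subgroup.one_closed[OF N(1)] by (metis r_inv)
  next
    case False
    then have xz: "x \<in> center G"
      using x central by (auto simp: eta_def)
    have xc: "x \<in> carrier G"
      using x by blast
    \<comment> \<open>\<open>M\<close> is a central subgroup strictly larger than \<open>N\<close>,
      so by maximality it contains \<open>k\<close>; this makes \<open>k\<close> a power of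
      \<open>x\<close> modulo \<open>N\<close>.\<close>
    define M where "M = N <#> generate G {x}"
    have M: "subgroup M G"
      unfolding M_def by (rule mult_norm_subgroup[OF normal subgroup_generate_singleton[OF xc]])
    have M_iff: "y \<in> M \<longleftrightarrow> (\<exists>h\<in>N. \<exists>i::int. y = h \<otimes> x [^] i)" for y
      unfolding M_def set_mult_def generate_pow[OF xc] by blast
    have Nc: "h \<in> carrier G" if "h \<in> N" for h
      using that N(1) subgroup.subset by blast
    have "N \<subseteq> M"
    proof
      fix h assume "h \<in> N"
      then show "h \<in> M"
        using M_iff Nc by (metis int_pow_0 r_one)
    qed
    moreover have "x \<in> M"
      using M_iff xc subgroup.one_closed[OF N(1)] by (metis int_pow_1 l_one)
    moreover have "M \<subseteq> center G"
    proof
      fix y assume "y \<in> M"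
      then obtain h and i :: int where "h \<in> N" "y = h \<otimes> x [^] i"
        using M_iff by blast
      then show "y \<in> center G"
        using N(2) subgroup_int_pow_closed[OF subgroup_center xz] subgroup.m_closed[OF subgroup_center] by blast
    qed
    ultimately have "k \<in> M"
      using maximal[of M] M N(3) x by (auto simp: S_def)
    then obtain h and i :: int where h: "h \<in> N" "k = h \<otimes> x [^] i"
      using M_iff by blast
    have "x [^] i \<otimes> inv k = inv h"
      unfolding h(2) using Nc[OF h(1)] xc by (simp add: inv_mult_group inv_cancel_left)
    then show ?thesis
      using subgroup.m_inv_closed[OF N(1) h(1)] by metis
  qed
  then have "socle_section p G N k"
    unfolding socle_section_def using normal N kc finite_subset[OF sub_eta[OF NS] fin] by auto
  then show ?thesis
    using that N(2) by blast
qed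

end

text \<open>The central \<open>N\<close> is killed by its order \<open>e\<close>, so
  \<open>x [^] e\<close> depends only on the coset of \<open>x\<close>, and comparability and
  divisibility lift from the quotient to \<open>e\<close>-th powers. Commutativity holds because one
  of any two elements is a central element times a power of the other.\<close>

lemma infinite_center_powers:
  fixes G :: "('a, 'b) monoid_scheme" (structure)
  assumes p: "prime p" and sec: "socle_section p G N k" and central: "N \<subseteq> center G"
    and inf: "infinite (center (G Mod N))"
  obtains e :: int where
    "\<forall>x\<in>carrier G. \<forall>y\<in>carrier G. x \<otimes> y = y \<otimes> x"
    "\<forall>x\<in>carrier G. \<forall>y\<in>carrier G.
      x [^] e \<in> generate G {y [^] e} \<or> y [^] e \<in> generate G {x [^] e}"
    "\<forall>x\<in>carrier G. \<forall>m>0. \<exists>y\<in>carrier G. x [^] e = (y [^] e) [^] int m"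
    "\<forall>x\<in>carrier G. \<exists>y\<in>carrier G. \<exists>h\<in>N. x = y [^] e \<otimes> h"
proof -
  interpret normal N G
    using sec by (simp add: socle_section_def)
  interpret Q: prime_socle "G Mod N" p "N #> k"
    by (rule socle_section_prime_socle[OF p sec])
  define e where "e = int (card N)"
  have e: "card N > 0"
    using sec subgroup.one_closed[OF is_subgroup] by (auto simp: socle_section_def card_gt_0_iff)
  have N_closed: "h \<in> carrier G" if "h \<in> N" for h
    using that subset by blast
  have N_pow: "h [^] e = \<one>" if h: "h \<in> N" for h
  proof -
    interpret NG: group "G\<lparr>carrier := N\<rparr>"
      using subgroup_imp_group[OF is_subgroup] .
    show ?thesis
      using NG.pow_order_eq_1[of h] h by (simp add: e_def order_def int_pow_int nat_pow_consistent[symmetric])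
  qed
  have N_mult_pow: "(h \<otimes> x) [^] e = x [^] e" if "h \<in> N" "x \<in> carrier G" for h x
  proof -
    have "h \<otimes> x = x \<otimes> h"
      using center_commute[of h G x] central that by auto
    then show ?thesis
      using int_pow_mult_distrib[of h x e] that N_pow N_closed by simp
  qed
  have pow_rep: "\<exists>h\<in>N. x = h \<otimes> y" if "N #> x = N #> y" "x \<in> carrier G" "y \<in> carrier G" for x y
  proof -
    have "x \<otimes> inv y \<in> N"
      using that rcos_eq_iff by blast
    moreover have "x = x \<otimes> inv y \<otimes> y"
      using that by (simp add: m_assoc)
    ultimately show ?thesis
      by blast
  qed
  have comparable: "\<exists>i::int. \<exists>h\<in>N. x = h \<otimes> y [^] i"
    if gen: "N #> x \<in> generate (G Mod N) {N #> y}" and xy: "x \<in> carrier G" "y \<in> carrier G" for x y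
  proof -
    obtain i :: int where "N #> x = N #> y [^] i"
      using gen Q.generate_singleton_iff[OF rcos_closed[OF xy(2)]] xy by (auto simp: FactGroup_int_pow)
    then show ?thesis
      using pow_rep xy by blast
  qed
  have cases: "(\<exists>i::int. \<exists>h\<in>N. x = h \<otimes> y [^] i) \<or> (\<exists>i::int. \<exists>h\<in>N. y = h \<otimes> x [^] i)"
    if "x \<in> carrier G" "y \<in> carrier G" for x y
    using Q.commuting_comparable[OF rcos_closed[OF that(1)] rcos_closed[OF that(2)]
        Q.infinite_center_commute[OF inf rcos_closed[OF that(1)] rcos_closed[OF that(2)]]]
      comparable that by blast
  have commute: "x \<otimes> y = y \<otimes> x"
    if "x = h \<otimes> y [^] i" "h \<in> N" "x \<in> carrier G" "y \<in> carrier G" for x y h and i :: int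
  proof -
    have "h \<otimes> y = y \<otimes> h"
      using center_commute[of h G y] central that by auto
    then have "x \<otimes> y = y \<otimes> h \<otimes> y [^] i"
      using that N_closed int_pow_mult[of y i 1] int_pow_mult[of y 1 i]
      by (metis add.commute int_pow_1 int_pow_closed m_assoc)
    then show ?thesis
      using that N_closed by (simp add: m_assoc)
  qed
  have gen: "x [^] e \<in> generate G {y [^] e}"
    if "x = h \<otimes> y [^] i" "h \<in> N" "x \<in> carrier G" "y \<in> carrier G" for x y h and i :: int
  proof -
    have "x [^] e = (y [^] e) [^] i"
      using that N_mult_pow[of h "y [^] i"] by (simp add: int_pow_pow mult.commute)
    then show ?thesis
      using that int_pow_in_generate[of "y [^] e" i] by simp
  qed
  have div: "\<exists>y\<in>carrier G. \<exists>h\<in>N. x = h \<otimes> y [^] int m" if x: "x \<in> carrier G" and m: "m > 0" for x m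
  proof -
    obtain Y where Y: "Y \<in> carrier (G Mod N)" "N #> x = Y [^]\<^bsub>G Mod N\<^esub> int m"
      using Q.infinite_center_divisible[OF inf rcos_closed[OF x] m] by blast
    then obtain y where "y \<in> carrier G" "Y = N #> y"
      by (auto simp: carrier_FactGroup)
    then show ?thesis
      using Y pow_rep[of x "y [^] int m"] x by (auto simp: FactGroup_int_pow)
  qed
  show ?thesis
  proof (rule that[of e]; intro ballI allI impI)
    fix x y assume xy: "x \<in> carrier G" "y \<in> carrier G"
    show "x \<otimes> y = y \<otimes> x"
      using cases[OF xy] commute[OF _ _ xy] commute[OF _ _ xy(2,1)] by metis
    show "x [^] e \<in> generate G {y [^] e} \<or> y [^] e \<in> generate G {x [^] e}"
      using cases[OF xy] gen xy by blast
  next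
    fix x and m :: nat assume x: "x \<in> carrier G" "m > 0"
    obtain y h where yh: "y \<in> carrier G" "h \<in> N" "x = h \<otimes> y [^] int m"
      using div[OF x] by blast
    then have "x [^] e = (y [^] e) [^] int m"
      using N_mult_pow[of h "y [^] int m"] by (simp add: int_pow_pow mult.commute)
    then show "\<exists>y\<in>carrier G. x [^] e = (y [^] e) [^] int m"
      using yh by blast
  next
    fix x assume x: "x \<in> carrier G"
    \<comment> \<open>Divisibility of the quotient, applied to the exponent \<open>e\<close>
      itself.\<close>
    obtain y h where yh: "y \<in> carrier G" "h \<in> N" "x = h \<otimes> y [^] e"
      using div[OF x e] by (auto simp: e_def)
    then have "x = y [^] e \<otimes> h"
      using center_commute[of h G "y [^] e"] central by auto
    then show "\<exists>y\<in>carrier G. \<exists>h\<in>N. x = y [^] e \<otimes> h"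
      using yh by blast
  qed
qed

section \<open>From the isomorphism type of K(G) to the section\<close>

lemma (in group) Ksub_cyclic_generator:
  assumes iso: "G\<lparr>carrier := Ksub G\<rparr> \<cong> integer_mod_group (p ^ n)" and inf: "infinite (carrier G)"
    and p: "prime p" and n: "n \<ge> 1"
  obtains k where "k \<in> Ksub G" "ord k = p ^ n" "finite (Ksub G)"
proof -
  let ?K = "G\<lparr>carrier := Ksub G\<rparr>" and ?Z = "integer_mod_group (p ^ n)"
  have pn: "p ^ n > 1"
    using prime_gt_1_nat[OF p] n by (intro one_less_power) auto
  have K: "group ?K"
    using subgroup_imp_group[OF subgroup_Ksub[OF inf]] .
  obtain f where f: "f \<in> iso ?Z ?K"
    using group.iso_sym[OF K iso] by (auto simp: is_iso_def)
  have bij: "bij_betw f (carrier ?Z) (Ksub G)" and hom: "f \<in> hom ?Z ?K"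
    using f by (auto simp: iso_def)
  have one: "1 \<in> carrier ?Z"
    using pn by (metis integer_mod_group_1 less_irrefl)
  define k where "k = f 1"
  have k: "k \<in> Ksub G"
    using one bij bij_betwE k_def by blast
  have kc: "k \<in> carrier G"
    using k by (simp add: Ksub_def)
  \<comment> \<open>Transport along \<open>f\<close> reads off the order of \<open>k\<close>: its
    \<open>j\<close>-th power is trivial exactly when \<open>p ^ n\<close> divides
    \<open>j\<close>.\<close>
  have "k [^] (j::nat) = f (int j mod int (p ^ n))" for j
    using hom_int_pow[OF hom one group_integer_mod_group K, of "int j"]
      int_pow_consistent[OF subgroup_Ksub[OF inf] k, of "int j"]
    by (simp add: k_def int_pow_integer_mod_group int_pow_int)
  moreover have "f 0 = \<one>"
    using hom_one[OF hom group_integer_mod_group K] by simp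
  moreover have "f i = f 0 \<longleftrightarrow> i = 0" if "i \<in> carrier ?Z" for i
    using that bij integer_mod_group_0 by (metis bij_betw_def inj_on_def)
  moreover have "int j mod int (p ^ n) \<in> carrier ?Z" for j
    using pn by (simp add: carrier_integer_mod_group)
  ultimately have "k [^] (j::nat) = \<one> \<longleftrightarrow> int j mod int (p ^ n) = 0" for j
    by metis
  then have "ord k = p ^ n"
    using kc by (simp only: ord_unique mod_eq_0_iff_dvd int_dvd_int_iff) simp
  moreover have "finite (carrier ?Z)"
    using prime_gt_0_nat[OF p] by (simp add: carrier_integer_mod_group)
  then have "finite (Ksub G)"
    using bij bij_betw_finite by blast
  ultimately show ?thesis
    using that k by blast
qed

lemma (in group) cyclic_Ksub_tight_section:
  assumes cnt: "countable (carrier G)" and inf: "infinite (carrier G)" and p: "prime p" and n: "n \<ge> 1"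
    and iso: "G\<lparr>carrier := Ksub G\<rparr> \<cong> integer_mod_group (p ^ n)"
  shows "\<exists>L N a. subgroup L G \<and> finite (rcosets L) \<and> tight_section p (G\<lparr>carrier := L\<rparr>) N a"
proof -
  obtain k where k: "k \<in> Ksub G" and ord_k: "ord k = p ^ n" and K_fin: "finite (Ksub G)"
    using Ksub_cyclic_generator[OF iso inf p n] .
  have kc: "k \<in> carrier G" and F_fin: "finite (eta k G)"
    using k countable_lesspoll_imp_finite[OF _ cnt] by (auto simp: Ksub_def)
  have kz: "k \<in> center G"
    unfolding center_def using finite_eta_imp_central[OF inf kc F_fin] kc by blast
  have ord_gt_1: "ord k > 1"
    unfolding ord_k using prime_gt_1_nat[OF p] n by (intro one_less_power) auto
  then have k1: "k \<noteq> \<one>"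
    by auto
  have torsion: "ord x \<noteq> 0" if "x \<in> carrier G" for x
    by (rule finite_eta_imp_torsion[OF kc k1 _ F_fin that]) (use ord_gt_1 in simp)
  have F_closed: "eta k G \<subseteq> carrier G"
    by (auto simp: eta_def)
  \<comment> \<open>Elements of \<open>eta k G\<close> that lie in \<open>C\<close> are central in
    \<open>C\<close> by construction.\<close>
  define C where "C = {x \<in> carrier G. \<forall>f\<in>eta k G. x \<otimes> f = f \<otimes> x}"
  let ?C = "G\<lparr>carrier := C\<rparr>"
  have C: "subgroup C G"
    unfolding C_def by (rule subgroup_commuting[OF F_closed])
  have C_idx: "finite (rcosets C)"
    unfolding C_def by (rule finite_index_commuting[OF F_fin F_closed eta_conjugate[OF kz]])
  have C_inf: "infinite C"
    by (rule infinite_finite_index[OF inf C C_idx])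
  have C_closed: "x \<in> carrier G" if "x \<in> C" for x
    using that by (simp add: C_def)
  interpret C: group ?C
    using subgroup_imp_group[OF C] .
  have kC: "k \<in> C"
    unfolding C_def using kc center_commute[OF kz] F_closed by blast
  have C_gen: "generate ?C {x} = generate G {x}" if "x \<in> C" for x
    by (rule generate_consistent[OF _ C]) (use that in simp)
  have C_pow: "x [^]\<^bsub>?C\<^esub> (i::int) = x [^] i" if "x \<in> C" for x i
    using int_pow_consistent[OF C that] by simp
  have eta_C: "eta k ?C \<subseteq> eta k G"
    using C_gen C_closed by (auto simp: eta_def)
  have "k \<in> center ?C"
    using kz kC C_closed by (auto simp: center_def)
  moreover have "eta k ?C \<subseteq> center ?C"
  proof
    fix f assume f: "f \<in> eta k ?C"
    then have "f \<in> eta k G" "f \<in> C"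
      using eta_C by (auto simp: eta_def)
    then show "f \<in> center ?C"
      by (auto simp: center_def C_def)
  qed
  moreover have "C.ord k = p ^ n"
    using ord_k kC kc C.ord_unique[of k "ord k"] pow_eq_id[OF kc] by (simp add: nat_pow_consistent[symmetric])
  ultimately obtain N where N: "N \<subseteq> center ?C" "socle_section p ?C N k"
    using C.central_eta_socle_section[OF p n] finite_subset[OF eta_C F_fin] by blast
  show ?thesis
  proof (cases "finite (center (?C Mod N))")
    case True
    then obtain M b where "tight_section p ?C M b"
      using finite_center_socle_section[OF p N(2)] C_inf by auto
    then show ?thesis
      using C C_idx by blast
  next
    case False
    obtain e :: int where
      comm: "\<forall>x\<in>carrier ?C. \<forall>y\<in>carrier ?C. x \<otimes>\<^bsub>?C\<^esub> y = y \<otimes>\<^bsub>?C\<^esub> x" and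
      chain: "\<forall>x\<in>carrier ?C. \<forall>y\<in>carrier ?C. x [^]\<^bsub>?C\<^esub> e \<in> generate ?C {y [^]\<^bsub>?C\<^esub> e}
        \<or> y [^]\<^bsub>?C\<^esub> e \<in> generate ?C {x [^]\<^bsub>?C\<^esub> e}" and
      div: "\<forall>x\<in>carrier ?C. \<forall>m>0.
        \<exists>y\<in>carrier ?C. x [^]\<^bsub>?C\<^esub> e = (y [^]\<^bsub>?C\<^esub> e) [^]\<^bsub>?C\<^esub> int m" and
      cover: "\<forall>x\<in>carrier ?C. \<exists>y\<in>carrier ?C. \<exists>h\<in>N. x = y [^]\<^bsub>?C\<^esub> e \<otimes>\<^bsub>?C\<^esub> h"
      using infinite_center_powers[OF p N(2,1) False] .
    \<comment> \<open>\<open>C\<close> is abelian in this case, so its \<open>e\<close>-th powers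
      form a subgroup, and together with the finite \<open>N\<close> they cover
      \<open>C\<close>.\<close>
    define D where "D = (\<lambda>x. x [^] e) ` C"
    have pow_C: "x [^] i \<in> C" if "x \<in> C" for x and i :: int
      using subgroup_int_pow_closed[OF C that] .
    have D_sub: "subgroup D G"
    proof (rule subgroupI)
      show "D \<subseteq> carrier G" "D \<noteq> {}"
        using C_closed kC by (auto simp: D_def)
    next
      fix x assume "x \<in> D"
      then obtain y where "y \<in> C" "x = y [^] e"
        by (auto simp: D_def)
      then show "inv x \<in> D"
        unfolding D_def using subgroup.m_inv_closed[OF C] C_closed
        by (intro image_eqI[of _ _ "inv y"]) (auto simp: int_pow_inv)
    next
      fix x y assume "x \<in> D" "y \<in> D"
      then obtain v w where vw: "v \<in> C" "w \<in> C" "x = v [^] e" "y = w [^] e"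
        by (auto simp: D_def)
      then have "x \<otimes> y = (v \<otimes> w) [^] e"
        using comm C_closed by (simp add: int_pow_mult_distrib)
      then show "x \<otimes> y \<in> D"
        unfolding D_def using vw subgroup.m_closed[OF C] by blast
    qed
    have C_conj: "x \<otimes> c \<otimes> inv x \<in> C" if x: "x \<in> carrier G" and c: "c \<in> C" for x c
    proof -
      have "x \<otimes> c \<otimes> inv x \<otimes> f = f \<otimes> (x \<otimes> c \<otimes> inv x)"
        if f: "f \<in> eta k G" for f
      proof -
        define f' where "f' = inv x \<otimes> f \<otimes> x"
        have fc: "f \<in> carrier G" "c \<in> carrier G"
          using f F_closed c C_closed by auto
        have "f' \<in> eta k G"
          unfolding f'_def using eta_conjugate[OF kz inv_closed[OF x] f] x by simp
        then have "c \<otimes> f' = f' \<otimes> c"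
          using c by (simp add: C_def)
        then have "x \<otimes> (c \<otimes> f') \<otimes> inv x = x \<otimes> (f' \<otimes> c) \<otimes> inv x"
          by simp
        then show ?thesis
          unfolding f'_def using x fc by (simp add: m_assoc inv_cancel_left)
      qed
      then show ?thesis
        using x C_closed[OF c] by (simp add: C_def)
    qed
    have D_normal: "D \<lhd> G"
    proof (rule normal_invI[OF D_sub])
      fix x d assume x: "x \<in> carrier G" and d: "d \<in> D"
      then obtain c where c: "c \<in> C" "d = c [^] e"
        by (auto simp: D_def)
      then have "x \<otimes> d \<otimes> inv x = (x \<otimes> c \<otimes> inv x) [^] e"
        using int_pow_conjugate[OF x C_closed] by simp
      then show "x \<otimes> d \<otimes> inv x \<in> D"
        unfolding D_def using C_conj[OF x c(1)] by blast
    qed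
    have D_idx: "finite (rcosets D)"
    proof (rule finite_index_trans[OF D_sub C C_idx])
      show "finite N" "N \<subseteq> carrier G"
        using N C_closed by (auto simp: socle_section_def center_def)
      fix x assume x: "x \<in> C"
      then obtain y h where "y \<in> C" "h \<in> N" "x = y [^] e \<otimes> h"
        using bspec[OF cover, of x] x by (auto simp: C_pow)
      then show "\<exists>d\<in>D. \<exists>h\<in>N. x = d \<otimes> h"
        by (auto simp: D_def)
    qed
    have D_inf: "infinite D"
      by (rule infinite_finite_index[OF inf D_sub D_idx])
    interpret divisible_chain G D k p n
    proof (intro divisible_chain.intro divisible_chain_axioms.intro)
      fix x y assume "x \<in> D" "y \<in> D"
      then obtain v w where vw: "v \<in> C" "w \<in> C" "x = v [^] e" "y = w [^] e"
        by (auto simp: D_def)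
      then show "x \<in> generate G {y} \<or> y \<in> generate G {x}"
        using bspec[OF bspec[OF chain, of v], of w] pow_C by (simp add: C_pow C_gen)
    next
      fix x and m :: nat assume "x \<in> D" "m > 0"
      then obtain v where v: "v \<in> C" "x = v [^] e"
        by (auto simp: D_def)
      have "\<exists>w\<in>C. v [^] e = (w [^] e) [^] int m"
        using bspec[OF div, of v, THEN spec, of m] v(1) \<open>m > 0\<close> pow_C by (simp add: C_pow cong: bex_cong)
      then obtain w where w: "w \<in> C" "x = (w [^] e) [^] int m"
        using v(2) by blast
      then show "\<exists>y\<in>D. x = y [^] int m"
        unfolding D_def by blast
    next
      \<comment> \<open>\<open>D\<close> is infinite, so some element of it has \<open>k\<close> as
        a power.\<close>
      have "\<not> D \<subseteq> eta k G"
        using D_inf F_fin finite_subset by blast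
      then obtain d where d: "d \<in> D" "k \<in> generate G {d}"
        using subgroup.subset[OF D_sub] by (auto simp: eta_def)
      then show "k \<in> D"
        using generate_singleton_in_subgroup[OF D_sub] by blast
    next
      \<comment> \<open>The finite \<open>Ksub G\<close> cannot contain \<open>D\<close>; through
        \<open>D_not_central\<close> this keeps \<open>D\<close> from being central.\<close>
      have "\<not> D \<subseteq> Ksub G"
        using D_inf K_fin finite_subset by blast
      then show "\<exists>x\<in>D. infinite (eta x G)"
        using finite_lesspoll_infinite[OF inf] subgroup.subset[OF D_sub] by (auto simp: Ksub_def)
    next
      fix x assume "x \<in> carrier G"
      then show "k \<otimes> x = x \<otimes> k"
        by (rule center_commute[OF kz])
    qed (fact is_group D_normal D_inf D_idx torsion p ord_k n F_fin)+
    show ?thesis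
      by (rule tight_section_exists)
  qed
qed

theorem theorem4p3:
  fixes G :: "('a, 'b) monoid_scheme" and p n :: nat
  assumes "group G"
    and "countable (carrier G)"
    and "infinite (carrier G)"
    and "prime p"
    and "n \<ge> 1"
    and "G\<lparr>carrier := Ksub G\<rparr> \<cong> integer_mod_group (p ^ n)"
  shows "\<exists>L N. subgroup L G \<and> finite (rcosets\<^bsub>G\<^esub> L) \<and> N \<lhd> G\<lparr>carrier := L\<rparr> \<and>
    (let H = G\<lparr>carrier := L\<rparr> Mod N in
       infinite (carrier H) \<and> p_group p H \<and>
       (\<exists>a\<in>carrier H. Ksub H = generate H {a} \<and>
          H\<lparr>carrier := Ksub H\<rparr> \<cong> integer_mod_group p \<and>
          eta a H = {\<one>\<^bsub>H\<^esub>}))"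
proof -
  interpret group G by fact
  obtain L N a where L: "subgroup L G" "finite (rcosets\<^bsub>G\<^esub> L)" "tight_section p (G\<lparr>carrier := L\<rparr>) N a"
    using cyclic_Ksub_tight_section[OF assms(2-6)] by blast
  interpret L: group "G\<lparr>carrier := L\<rparr>"
    using subgroup_imp_group[OF L(1)] .
  have "infinite (carrier (G\<lparr>carrier := L\<rparr>))" "countable (carrier (G\<lparr>carrier := L\<rparr>))"
    using infinite_finite_index[OF assms(3) L(1,2)] countable_subset[OF subgroup.subset[OF L(1)] assms(2)] by auto
  note tight_section_quotient[OF assms(4) L(3) this]
  moreover have "N \<lhd> G\<lparr>carrier := L\<rparr>"
    using L(3) by (simp add: tight_section_def socle_section_def)
  ultimately show ?thesis
    using L(1,2) unfolding Let_def by blast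
qed

end
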